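(* Let $p$ be an odd prime, $A$ the mod $p$ Steenrod algebra and $P=\widetilde H^*(B\mathbb{Z}/p;\mathbb{F}_p)$. Then $\operatorname{Ext}_A^{0,*}(P,\mathbb{F}_p)$ has an $\mathbb{F}_p$-basis consisting of all the elements 1. $\widehat h_i:=\left[ab^{[(p-1)p^i-1]}\right]\in\operatorname{Ext}_A^{0,2(p-1)p^i-1}(P,\mathbb{F}_p)$, $i\ge0$; 2. $\widehat h_i(k):=\left[ab^{[kp^i-1]}\right]\in\operatorname{Ext}_A^{0,2kp^i-1}(P,\mathbb{F}_p)$, $i\ge0$, $1\le k<p-1$.
   Context: $H^*(B\mathbb{Z}/p;\mathbb{F}_p)=E(x)\otimes\mathbb{F}_p[y]$ with $|x|=1$, $y=\beta x$, $|y|=2$. $H=P^\#=\widetilde H_*(B\mathbb{Z}/p;\mathbb{F}_p)$ has the basis $\{a^\epsilon b^{[t]}:\epsilon\in\{0,1\},t\ge0,t+\epsilon>0\}$ dual to the basis $\{x^\epsilon y^t\}$ of $P$, with $|a^\epsilon b^{[t]}|=2t+\epsilon$, and carries the dual right $A$-action. $\operatorname{Ext}_A^{0,t}(P,\mathbb{F}_p)$ is identified with the space of elements of $H_t$ annihilated by the augmentation ideal $\bar A$ of $A$; $[h]$ denotes the class of such an element $h$. *)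

theory Defs
  imports
    "Berlekamp_Zassenhaus.Finite_Field"
    "HOL-Library.Poly_Mapping"
    "HOL-Computational_Algebra.Formal_Power_Series"
begin

text \<open>
  Throughout, \<open>F_p\<close> is \<^typ>\<open>'p mod_ring\<close> with \<open>p = CARD('p)\<close> prime.

  The Steenrod algebra is presented by generators and relations.  That its action on the cohomology
  is well defined amounts to two congruences between binomial coefficients, which come first.  They
  are obtained in the manner of Bullett and Macdonald: with \<open>u = (1 - t)^(p-1)\<close> and \<open>s = t u\<close>, the
  total operations satisfy \<open>P(s) P(1) = P(u) P(t^p)\<close>, and a power of \<open>1/(1 - t)\<close> extracts the
  coefficient of \<open>s^a\<close>.
\<close>

section \<open>The Adem relations as binomial identities\<close>


lemma freshman:
  fixes x y :: "'a::comm_ring_1"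
  assumes p: "prime p" and z: "of_nat p = (0::'a)"
  shows "(x + y) ^ p = x ^ p + y ^ p"
proof -
  have "p > 0" using p by (simp add: prime_gt_0_nat)
  have *: "of_nat (p choose k) = (0::'a)" if "0 < k" "k < p" for k
  proof -
    have "p dvd (p choose k)" using that p by (intro dvd_choose_prime) auto
    then show ?thesis using z by (metis dvd_def mult_zero_left of_nat_mult)
  qed
  have "(x + y) ^ p = (\<Sum>k\<le>p. of_nat (p choose k) * x ^ k * y ^ (p - k))"
    by (rule binomial_ring)
  also have "\<dots> = (\<Sum>k\<in>{0, p}. of_nat (p choose k) * x ^ k * y ^ (p - k))"
    by (rule sum.mono_neutral_right) (use * in \<open>auto simp: not_less\<close>)
  also have "\<dots> = x ^ p + y ^ p" using \<open>p > 0\<close> by simp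
  finally show ?thesis .
qed

lemma coeff_one_plus_power:
  "coeff ([:1, c:] ^ m) i = of_nat (m choose i) * (c::'a::comm_ring_1) ^ i"
proof (induction m arbitrary: i)
  case 0 then show ?case by (cases i) auto
next
  case (Suc m)
  show ?case by (cases i) (auto simp: Suc algebra_simps)
qed

definition adS :: "nat \<Rightarrow> nat \<Rightarrow> nat \<Rightarrow> 'a::comm_ring_1 \<Rightarrow> 'a \<Rightarrow> nat \<Rightarrow> 'a" where
  "adS p n e c d N = (\<Sum>b\<le>N. of_nat ((n choose b) * ((n + e + b * (p - 1)) choose (N - b))) * d ^ b * c ^ (N - b))"

definition adG :: "nat \<Rightarrow> 'a::comm_ring_1 \<Rightarrow> 'a \<Rightarrow> 'a poly" where
  "adG p c d = [:1, c:] + monom d 1 * [:1, c:] ^ p"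

lemma coeff_adG:
  assumes p: "p > 0"
  shows "coeff ([:1, c:] ^ e * adG p c d ^ n) N = adS p n e c d N"
proof -
  have "[:1, c:] ^ e * adG p c d ^ n
     = (\<Sum>b\<le>n. monom (of_nat (n choose b) * d ^ b) b * [:1, c:] ^ (n + e + b * (p - 1)))"
  proof -
    have "adG p c d ^ n = (\<Sum>b\<le>n. of_nat (n choose b) * (monom d 1 * [:1, c:] ^ p) ^ b * [:1, c:] ^ (n - b))"
      unfolding adG_def by (subst add.commute, rule binomial_ring)
    also have "[:1, c:] ^ e * \<dots> = (\<Sum>b\<le>n. monom (of_nat (n choose b) * d ^ b) b * [:1, c:] ^ (n + e + b * (p - 1)))"
      unfolding sum_distrib_left
    proof (rule sum.cong[OF refl])
      fix b assume "b \<in> {..n}"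
      then have "e + p * b + (n - b) = n + e + b * (p - 1)"
        using p by (cases p) (auto simp: algebra_simps)
      moreover have "[:1, c:] ^ e * (of_nat (n choose b) * (monom d 1 * [:1, c:] ^ p) ^ b * [:1, c:] ^ (n - b))
         = of_nat (n choose b) * monom d 1 ^ b * [:1, c:] ^ (e + p * b + (n - b))"
        by (simp add: power_mult_distrib power_add mult_ac flip: power_mult)
      moreover have "of_nat (n choose b) * monom d 1 ^ b = monom (of_nat (n choose b) * d ^ b) b"
        by (simp add: monom_power of_nat_poly smult_monom)
      ultimately show "[:1, c:] ^ e * (of_nat (n choose b) * (monom d 1 * [:1, c:] ^ p) ^ b * [:1, c:] ^ (n - b))
         = monom (of_nat (n choose b) * d ^ b) b * [:1, c:] ^ (n + e + b * (p - 1))"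
        by (simp only:)
    qed
    finally show ?thesis .
  qed
  then have "coeff ([:1, c:] ^ e * adG p c d ^ n) N
    = (\<Sum>b\<le>n. if b \<le> N then of_nat (n choose b) * d ^ b * (of_nat ((n + e + b * (p - 1)) choose (N - b)) * c ^ (N - b)) else 0)"
    by (simp add: coeff_sum coeff_monom_mult coeff_one_plus_power not_le cong: if_cong)
  also have "\<dots> = (\<Sum>b\<in>{..n}\<inter>{..N}. of_nat (n choose b) * d ^ b * (of_nat ((n + e + b * (p - 1)) choose (N - b)) * c ^ (N - b)))"
    by (rule sum.mono_neutral_cong_right) auto
  also have "\<dots> = adS p n e c d N" unfolding adS_def
    by (rule sum.mono_neutral_cong_left) (auto simp: mult_ac, metis binomial_eq_0 not_le of_nat_0 mult_zero_left mult_zero_right)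
  finally show ?thesis .
qed

context
  fixes p :: nat and t u s :: "'a::comm_ring_1"
  assumes p: "prime p" and z: "of_nat p = (0::'a)"
    and u: "u = (1 - t) ^ (p - 1)" and s: "s = t * u"
begin

lemma ad_us: "u + t ^ p = 1 + s"
proof -
  have "p > 0" using p by (simp add: prime_gt_0_nat)
  have "(1 - t) ^ p + t ^ p = 1" using freshman[OF p z, of "1 - t" t] by simp
  moreover have "(1 - t) ^ p = u - s"
    using \<open>p > 0\<close> unfolding u s by (cases p) (auto simp: algebra_simps)
  ultimately show ?thesis by (simp add: algebra_simps)
qed

lemma adG_eq: "adG p s 1 = adG p u (t ^ p)"
proof -
  have zp: "of_nat p = (0::'a poly)" by (simp add: of_nat_poly z)
  have A: "[:1, c:] ^ p = 1 + monom (c ^ p) p" for c :: 'a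
  proof -
    have "[:1, c:] = 1 + monom c 1" by (simp add: monom_Suc one_pCons monom_0)
    then show ?thesis using freshman[OF p zp, of 1 "monom c 1"] by (simp add: monom_power)
  qed
  have "adG p c d = [:1, c + d:] + monom (d * c ^ p) (Suc p)" for c d :: 'a
    unfolding adG_def A
    by (simp add: distrib_left mult_monom) (simp add: monom_Suc monom_0 algebra_simps)
  then show ?thesis using ad_us by (simp add: s power_mult_distrib add.commute)
qed

lemma adS1: "adS p n 0 s 1 N = adS p n 0 u (t ^ p) N"
proof -
  have "p > 0" using p by (simp add: prime_gt_0_nat)
  from coeff_adG[OF this, of _ 0] show ?thesis by (simp flip: coeff_adG[OF \<open>p > 0\<close>] add: adG_eq)
qed

lemma adS2: "adS p n 1 s 1 N = (1 - t) * adS p n 0 u (t ^ p) N + t * adS p n 1 u (t ^ p) N"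
proof -
  have "p > 0" using p by (simp add: prime_gt_0_nat)
  have "[:1, s:] = smult (1 - t) 1 + smult t [:1, u:]" by (simp add: s one_pCons)
  then have "[:1, s:] ^ 1 * adG p s 1 ^ n = smult (1 - t) ([:1, u:] ^ 0 * adG p u (t ^ p) ^ n)
     + smult t ([:1, u:] ^ 1 * adG p u (t ^ p) ^ n)"
    unfolding adG_eq by (simp only: power_one_right power_0 distrib_right mult_smult_left)
  then have "coeff ([:1, s:] ^ 1 * adG p s 1 ^ n) N = coeff (smult (1 - t) ([:1, u:] ^ 0 * adG p u (t ^ p) ^ n)
     + smult t ([:1, u:] ^ 1 * adG p u (t ^ p) ^ n)) N" by (rule arg_cong)
  then show ?thesis unfolding coeff_add coeff_smult coeff_adG[OF \<open>p > 0\<close>] .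
qed

end

lemma geom_power_nth:
  fixes v :: "'a::comm_ring_1 fps"
  assumes v: "v * (1 - fps_X) = 1"
  shows "fps_nth (v ^ Suc m) d = of_nat ((m + d) choose d)"
proof -
  have *: "fps_nth g d = (\<Sum>i\<le>d. fps_nth f i)" if "g * (1 - fps_X) = f" for f g :: "'a fps" and d
  proof (induction d)
    case 0 have "fps_nth f 0 = fps_nth g 0" unfolding that[symmetric] by (simp add: algebra_simps)
    then show ?case by simp
  next
    case (Suc d)
    have "fps_nth f (Suc d) = fps_nth g (Suc d) - fps_nth g d" unfolding that[symmetric] by (simp add: algebra_simps)
    then show ?case using Suc by simp
  qed
  show ?thesis
  proof (induction m arbitrary: d)
    case 0
    have "v ^ Suc 0 * (1 - fps_X) = 1" using v by simp
    from *[OF this, of d] show ?case by (simp add: sum.delta)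
  next
    case (Suc m)
    have "v ^ Suc (Suc m) * (1 - fps_X) = v ^ Suc m"
      using v by (simp add: mult_ac) (metis mult.commute mult.left_commute mult_1 )
    from *[OF this, of d] have "fps_nth (v ^ Suc (Suc m)) d = of_nat (\<Sum>i\<le>d. (m + i) choose i)"
      by (simp only: Suc of_nat_sum)
    also have "(\<Sum>i\<le>d. (m + i) choose i) = ((Suc m + d) choose d)"
      using sum_choose_lower[of m d] by simp
    finally show ?case .
  qed
qed

lemma one_minus_power_nth:
  "fps_nth ((1 - fps_X) ^ m) d = (-1) ^ d * (of_nat (m choose d) :: 'a::comm_ring_1)"
proof (induction m arbitrary: d)
  case 0 then show ?case by (cases d) auto
next
  case (Suc m)
  show ?case by (cases d) (auto simp: Suc algebra_simps)
qed

context
  fixes p :: nat and v u s :: "'a::comm_ring_1 fps"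
  assumes p: "prime p" and z: "of_nat p = (0::'a)"
    and v: "v * (1 - fps_X) = 1"
    and u: "u = (1 - fps_X) ^ (p - 1)" and s: "s = fps_X * u"
begin

lemma v_cancel: "k \<le> m \<Longrightarrow> (1 - fps_X) ^ m * v ^ k = (1 - fps_X) ^ (m - k)"
proof -
  assume "k \<le> m"
  then have "(1 - fps_X :: 'a fps) ^ m = (1 - fps_X) ^ (m - k) * (1 - fps_X) ^ k"
    by (simp flip: power_add)
  moreover have "(1 - fps_X) ^ k * v ^ k = 1" using v by (simp flip: power_mult_distrib add: mult.commute)
  ultimately show ?thesis by (simp add: mult.assoc)
qed

lemma v_cancel': "m \<le> k \<Longrightarrow> (1 - fps_X) ^ m * v ^ k = v ^ (k - m)"
proof -
  assume "m \<le> k"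
  then have "v ^ k = v ^ m * v ^ (k - m)"
    by (simp flip: power_add)
  moreover have "(1 - fps_X) ^ m * v ^ m = 1" using v by (simp flip: power_mult_distrib add: mult.commute)
  ultimately show ?thesis by (simp flip: mult.assoc)
qed

lemma extract_s: "fps_nth (s ^ a' * v ^ Suc ((p - 1) * a)) a = (if a' = a then 1 else 0)"
proof (cases "a' \<le> a")
  case False
  then show ?thesis by (simp add: s power_mult_distrib mult.assoc fps_X_power_mult_nth)
next
  case True
  define d where "d = a - a'"
  have a: "a = a' + d" using True d_def by simp
  have p0: "p > 0" using p by (simp add: prime_gt_0_nat)
  have "s ^ a' * v ^ Suc ((p - 1) * a) = fps_X ^ a' * ((1 - fps_X) ^ ((p - 1) * a') * v ^ Suc ((p - 1) * a))"
    by (simp add: s u power_mult_distrib mult_ac flip: power_mult)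
  also have "(1 - fps_X) ^ ((p - 1) * a') * v ^ Suc ((p - 1) * a) = v ^ (Suc ((p - 1) * a) - (p - 1) * a')"
    by (rule v_cancel') (simp add: a distrib_left)
  also have "Suc ((p - 1) * a) - (p - 1) * a' = Suc ((p - 1) * d)"
    by (simp add: a distrib_left)
  finally have "fps_nth (s ^ a' * v ^ Suc ((p - 1) * a)) a = of_nat (((p - 1) * d + d) choose d)"
    by (simp only: fps_X_power_mult_nth geom_power_nth[OF v]) (simp add: a)
  also have "(p - 1) * d + d = p * d" using p0 by (cases p) auto
  finally have e: "fps_nth (s ^ a' * v ^ Suc ((p - 1) * a)) a = of_nat ((p * d) choose d)" .
  show ?thesis
  proof (cases "d = 0")
    case True then show ?thesis using e a by simp
  next
    case False
    then obtain d' where d': "d = Suc d'" by (cases d) auto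
    obtain q where q: "p * d = Suc q" using False p0 by (cases "p * d") auto
    have "d * (Suc q choose d) = Suc q * (q choose d')" unfolding d' by (rule Suc_times_binomial)
    then have "d * ((p * d) choose d) = p * d * (q choose d')" unfolding q[symmetric] .
    then have "d * ((p * d) choose d) = d * (p * (q choose d'))" by (simp only: mult_ac)
    then have "((p * d) choose d) = p * (q choose d')" using False by simp
    then have "of_nat ((p * d) choose d) = (0::'a)" using z by simp
    then show ?thesis using e a False by simp
  qed
qed

lemma extract_adS_s:
  assumes "a \<le> N"
  shows "fps_nth (adS p n e s 1 N * v ^ Suc ((p - 1) * a)) a
    = of_nat ((n choose (N - a)) * ((n + e + (N - a) * (p - 1)) choose a))"
proof -
  have "fps_nth (adS p n e s 1 N * v ^ Suc ((p - 1) * a)) a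
    = (\<Sum>b\<le>N. of_nat ((n choose b) * ((n + e + b * (p - 1)) choose (N - b)))
        * fps_nth (s ^ (N - b) * v ^ Suc ((p - 1) * a)) a)"
    unfolding adS_def sum_distrib_right fps_sum_nth
    by (rule sum.cong) (simp_all only: fps_of_nat[symmetric] power_one mult_1_right mult.assoc fps_mult_left_const_nth)
  also have "\<dots> = (\<Sum>b\<le>N. if b = N - a then of_nat ((n choose b) * ((n + e + b * (p - 1)) choose (N - b))) else 0)"
    by (rule sum.cong) (use assms in \<open>auto simp only: extract_s atMost_iff split: if_splits\<close>, auto)
  also have "\<dots> = of_nat ((n choose (N - a)) * ((n + e + (N - a) * (p - 1)) choose a))"
    using assms by (simp add: sum.delta)
  finally show ?thesis .
qed

lemma sign: "p * i + r = a \<Longrightarrow> (-1::'a) ^ r = (-1) ^ (a + i)"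
proof (cases "even p")
  case True
  then have "p = 2" using p primes_dvd_imp_eq two_is_prime_nat by blast
  then have "(1::'a) + 1 = 0" using z by simp
  then have "(-1::'a) = 1" by (metis add_eq_0_iff)
  then show ?thesis by (simp only: power_one)
next
  case False
  assume a: "p * i + r = a"
  have "even (a + i) = even r" using False by (auto simp flip: a)
  then show ?thesis by (metis minus_one_power_iff)
qed

lemma extract_u:
  assumes "a + b = N" "i \<le> N" "a < p * b + l" "l \<le> 1"
  shows "fps_nth ((1 - fps_X) ^ l * (u ^ (N - i) * fps_X ^ (p * i) * v ^ Suc ((p - 1) * a))) a
    = (if p * i \<le> a then (-1) ^ (a + i) * of_nat (((p - 1) * (b - i) + l - 1) choose (a - p * i)) else 0)"
proof (cases "p * i \<le> a")
  case False
  have "(1 - fps_X) ^ l * (u ^ (N - i) * fps_X ^ (p * i) * v ^ Suc ((p - 1) * a))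
    = fps_X ^ (p * i) * ((1 - fps_X) ^ l * u ^ (N - i) * v ^ Suc ((p - 1) * a))" by (simp only: mult_ac)
  then show ?thesis using False by (simp only: fps_X_power_mult_nth) simp
next
  case True
  have p2: "p \<ge> 2" using p by (simp add: prime_ge_2_nat)
  have "p * i < p * b + l" using True assms(3) by simp
  then have i: "i \<le> b" "l = 0 \<longrightarrow> i < b"
  proof -
    show "i \<le> b"
    proof (rule ccontr)
      assume "\<not> i \<le> b" then have "p * Suc b \<le> p * i" by (intro mult_le_mono) auto
      then show False using \<open>p * i < p * b + l\<close> p2 assms(4) by simp
    qed
    show "l = 0 \<longrightarrow> i < b" using \<open>p * i < p * b + l\<close> by auto
  qed
  obtain c where c: "b = i + c" using i le_Suc_ex by blast
  have N: "N - i = a + c" using assms(1) c by simp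
  have "(1 - fps_X) ^ l * (u ^ (N - i) * fps_X ^ (p * i) * v ^ Suc ((p - 1) * a))
    = fps_X ^ (p * i) * ((1 - fps_X) ^ ((p - 1) * (a + c) + l) * v ^ Suc ((p - 1) * a))"
    unfolding N u by (simp only: power_mult power_add mult_ac)
  also have "(1 - fps_X) ^ ((p - 1) * (a + c) + l) * v ^ Suc ((p - 1) * a)
     = (1 - fps_X) ^ ((p - 1) * (a + c) + l - Suc ((p - 1) * a))"
  proof (rule v_cancel)
    have "(p - 1) * c + l \<ge> 1" using i c p2 by (cases "l = 0") auto
    then show "Suc ((p - 1) * a) \<le> (p - 1) * (a + c) + l" by (simp add: distrib_left)
  qed
  also have "(p - 1) * (a + c) + l - Suc ((p - 1) * a) = (p - 1) * (b - i) + l - 1"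
    by (simp add: c distrib_left)
  finally show ?thesis using True sign[of i "a - p * i" a]
    by (simp only: fps_X_power_mult_nth one_minus_power_nth) simp
qed

lemma extract_u':
  assumes "a + b = N" "i \<le> N" "a \<le> p * b"
  shows "fps_nth (fps_X * (u ^ (N - i) * fps_X ^ (p * i) * v ^ Suc ((p - 1) * a))) a
    = (if p * i < a then - ((-1) ^ (a + i)) * of_nat (((p - 1) * (b - i) - 1) choose (a - p * i - 1)) else 0)"
proof (cases "p * i < a")
  case False
  have "fps_X * (u ^ (N - i) * fps_X ^ (p * i) * v ^ Suc ((p - 1) * a))
    = fps_X ^ Suc (p * i) * (u ^ (N - i) * v ^ Suc ((p - 1) * a))" by (simp only: mult_ac power_Suc)
  then show ?thesis using False by (simp only: fps_X_power_mult_nth) simp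
next
  case True
  have p2: "p \<ge> 2" using p by (simp add: prime_ge_2_nat)
  have "p * i < p * b" using True assms(3) by linarith
  then have i: "i < b" using mult_less_cancel1 by blast
  then obtain c where c: "b = i + c" "c > 0" using less_imp_add_positive by blast
  have N: "N - i = a + c" using assms(1) c by simp
  have "fps_X * (u ^ (N - i) * fps_X ^ (p * i) * v ^ Suc ((p - 1) * a))
    = fps_X ^ Suc (p * i) * ((1 - fps_X) ^ ((p - 1) * (a + c)) * v ^ Suc ((p - 1) * a))"
    unfolding N u by (simp only: power_mult mult_ac power_Suc)
  also have "(1 - fps_X) ^ ((p - 1) * (a + c)) * v ^ Suc ((p - 1) * a)
     = (1 - fps_X) ^ ((p - 1) * (a + c) - Suc ((p - 1) * a))"
  proof (rule v_cancel)
    have "(p - 1) * c \<ge> 1" using c p2 by auto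
    then show "Suc ((p - 1) * a) \<le> (p - 1) * (a + c)" by (simp add: distrib_left)
  qed
  also have "(p - 1) * (a + c) - Suc ((p - 1) * a) = (p - 1) * (b - i) - 1"
    by (simp add: c distrib_left)
  finally have *: "fps_nth (fps_X * (u ^ (N - i) * fps_X ^ (p * i) * v ^ Suc ((p - 1) * a))) a
     = (-1) ^ (a - Suc (p * i)) * of_nat (((p - 1) * (b - i) - 1) choose (a - Suc (p * i)))"
    using True by (simp only: fps_X_power_mult_nth one_minus_power_nth) simp
  have "(-1::'a) ^ (a + i) = (-1) ^ (a - p * i)" using sign[of i "a - p * i" a] True by simp
  also have "a - p * i = Suc (a - Suc (p * i))" using True by simp
  finally show ?thesis using True * by simp
qed

lemma adS_mult:
  "fps_nth (f * adS p n e u (fps_X ^ p) N * w) a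
    = (\<Sum>i\<le>N. of_nat ((n choose i) * ((n + e + i * (p - 1)) choose (N - i)))
        * fps_nth (f * (u ^ (N - i) * fps_X ^ (p * i) * w)) a)"
proof -
  have "f * adS p n e u (fps_X ^ p) N * w = (\<Sum>i\<le>N. fps_const (of_nat ((n choose i) * ((n + e + i * (p - 1)) choose (N - i))))
        * (f * (u ^ (N - i) * fps_X ^ (p * i) * w)))"
    unfolding adS_def sum_distrib_right sum_distrib_left
    by (rule sum.cong) (simp_all only: fps_of_nat mult_ac flip: power_mult)
  then show ?thesis by (simp only: fps_sum_nth fps_mult_left_const_nth)
qed

lemma sum_restrict:
  assumes "a + b = N"
  shows "(\<Sum>i\<le>N. if p * i \<le> a then g i else 0) = (\<Sum>i | p * i \<le> a. g i)"
    and "(\<Sum>i\<le>N. if p * i < a then g i else 0) = (\<Sum>i | p * i < a. g i)"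
proof -
  have p0: "p > 0" using p by (simp add: prime_gt_0_nat)
  have "i \<le> N" if "p * i \<le> a" for i
    using that assms p0 by (metis le_add1 le_trans mult_le_mono1 mult_1 One_nat_def Suc_leI)
  then show "(\<Sum>i\<le>N. if p * i \<le> a then g i else 0) = (\<Sum>i | p * i \<le> a. g i)"
    "(\<Sum>i\<le>N. if p * i < a then g i else 0) = (\<Sum>i | p * i < a. g i)"
    by (auto simp: sum.If_cases intro!: sum.cong)
qed

lemma adem1_aux:
  assumes "a < p * b"
  shows "of_nat ((n choose b) * ((n + b * (p - 1)) choose a)) =
    (\<Sum>i | p * i \<le> a. (-1) ^ (a + i) * of_nat (((p - 1) * (b - i) - 1) choose (a - p * i))
       * (of_nat ((n choose i) * ((n + i * (p - 1)) choose (a + b - i))) :: 'a))"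
proof -
  define N where "N = a + b"
  have zf: "of_nat p = (0 :: 'a fps)" by (simp add: z flip: fps_of_nat)
  have "of_nat ((n choose b) * ((n + b * (p - 1)) choose a)) = fps_nth (adS p n 0 s 1 N * v ^ Suc ((p - 1) * a)) a"
    by (subst extract_adS_s) (auto simp: N_def)
  also have "\<dots> = fps_nth ((1 - fps_X) ^ 0 * adS p n 0 u (fps_X ^ p) N * v ^ Suc ((p - 1) * a)) a"
    by (simp only: adS1[OF p zf u s] power_0 mult_1)
  also have "\<dots> = (\<Sum>i\<le>N. if p * i \<le> a then (-1) ^ (a + i) * of_nat (((p - 1) * (b - i) - 1) choose (a - p * i))
       * (of_nat ((n choose i) * ((n + i * (p - 1)) choose (a + b - i))) :: 'a) else 0)"
    unfolding adS_mult
  proof (intro sum.cong refl)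
    fix i assume "i \<in> {..N}"
    then show "of_nat ((n choose i) * (n + 0 + i * (p - 1) choose (N - i))) *
         fps_nth ((1 - fps_X) ^ 0 * (u ^ (N - i) * fps_X ^ (p * i) * v ^ Suc ((p - 1) * a))) a =
        (if p * i \<le> a then (-1) ^ (a + i) * of_nat (((p - 1) * (b - i) - 1) choose (a - p * i))
       * (of_nat ((n choose i) * ((n + i * (p - 1)) choose (a + b - i))) :: 'a) else 0)"
      using assms by (subst extract_u[of a b]) (auto simp: N_def mult_ac)
  qed
  also have "\<dots> = (\<Sum>i | p * i \<le> a. (-1) ^ (a + i) * of_nat (((p - 1) * (b - i) - 1) choose (a - p * i))
       * (of_nat ((n choose i) * ((n + i * (p - 1)) choose (a + b - i))) :: 'a))"
    by (rule sum_restrict) (simp add: N_def)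
  finally show ?thesis .
qed

lemma adem2_aux:
  assumes "a \<le> p * b"
  shows "of_nat ((n choose b) * ((n + 1 + b * (p - 1)) choose a)) =
    (\<Sum>i | p * i \<le> a. (-1) ^ (a + i) * of_nat (((p - 1) * (b - i)) choose (a - p * i))
       * (of_nat ((n choose i) * ((n + i * (p - 1)) choose (a + b - i))) :: 'a))
    - (\<Sum>i | p * i < a. (-1) ^ (a + i) * of_nat (((p - 1) * (b - i) - 1) choose (a - p * i - 1))
       * (of_nat ((n choose i) * ((n + 1 + i * (p - 1)) choose (a + b - i))) :: 'a))"
proof -
  define N where "N = a + b"
  have zf: "of_nat p = (0 :: 'a fps)" by (simp add: z flip: fps_of_nat)
  let ?w = "v ^ Suc ((p - 1) * a)"
  have "of_nat ((n choose b) * ((n + 1 + b * (p - 1)) choose a)) = fps_nth (adS p n 1 s 1 N * ?w) a"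
    by (subst extract_adS_s) (auto simp: N_def)
  also have "\<dots> = fps_nth ((1 - fps_X) ^ 1 * adS p n 0 u (fps_X ^ p) N * ?w) a
      + fps_nth (fps_X * adS p n 1 u (fps_X ^ p) N * ?w) a"
    by (simp only: adS2[OF p zf u s] power_one_right distrib_right fps_add_nth)
  also have "fps_nth ((1 - fps_X) ^ 1 * adS p n 0 u (fps_X ^ p) N * ?w) a = (\<Sum>i\<le>N. if p * i \<le> a then (-1) ^ (a + i) * of_nat (((p - 1) * (b - i)) choose (a - p * i))
       * (of_nat ((n choose i) * ((n + i * (p - 1)) choose (a + b - i))) :: 'a) else 0)"
    unfolding adS_mult
  proof (intro sum.cong refl)
    fix i assume "i \<in> {..N}"
    then show "of_nat ((n choose i) * (n + 0 + i * (p - 1) choose (N - i))) *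
         fps_nth ((1 - fps_X) ^ 1 * (u ^ (N - i) * fps_X ^ (p * i) * ?w)) a =
        (if p * i \<le> a then (-1) ^ (a + i) * of_nat (((p - 1) * (b - i)) choose (a - p * i))
       * (of_nat ((n choose i) * ((n + i * (p - 1)) choose (a + b - i))) :: 'a) else 0)"
      using assms by (subst extract_u[of a b]) (auto simp: N_def mult_ac)
  qed
  also have "\<dots> = (\<Sum>i | p * i \<le> a. (-1) ^ (a + i) * of_nat (((p - 1) * (b - i)) choose (a - p * i))
       * (of_nat ((n choose i) * ((n + i * (p - 1)) choose (a + b - i))) :: 'a))"
    by (rule sum_restrict) (simp add: N_def)
  also have "fps_nth (fps_X * adS p n 1 u (fps_X ^ p) N * ?w) a = (\<Sum>i\<le>N. if p * i < a then - ((-1) ^ (a + i) * of_nat (((p - 1) * (b - i) - 1) choose (a - p * i - 1))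
       * (of_nat ((n choose i) * ((n + 1 + i * (p - 1)) choose (a + b - i))) :: 'a)) else 0)"
    unfolding adS_mult
  proof (intro sum.cong refl)
    fix i assume "i \<in> {..N}"
    then show "of_nat ((n choose i) * (n + 1 + i * (p - 1) choose (N - i))) *
         fps_nth (fps_X * (u ^ (N - i) * fps_X ^ (p * i) * ?w)) a =
        (if p * i < a then - ((-1) ^ (a + i) * of_nat (((p - 1) * (b - i) - 1) choose (a - p * i - 1))
       * (of_nat ((n choose i) * ((n + 1 + i * (p - 1)) choose (a + b - i))) :: 'a)) else 0)"
      using assms by (subst extract_u'[of a b]) (auto simp: N_def mult_ac)
  qed
  also have "\<dots> = (\<Sum>i | p * i < a. - ((-1) ^ (a + i) * of_nat (((p - 1) * (b - i) - 1) choose (a - p * i - 1))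
       * (of_nat ((n choose i) * ((n + 1 + i * (p - 1)) choose (a + b - i))) :: 'a)))"
    by (rule sum_restrict) (simp add: N_def)
  finally show ?thesis by (simp add: sum_negf)
qed

end

lemma geom_exists: "inverse (1 - fps_X) * (1 - fps_X :: 'p::prime_card mod_ring fps) = 1"
  by (rule inverse_mult_eq_1) simp

lemmas adem_binomial1 =
  adem1_aux[OF prime_card of_nat_card_eq_0 geom_exists refl refl]
lemmas adem_binomial2 =
  adem2_aux[OF prime_card of_nat_card_eq_0 geom_exists refl refl]


section \<open>Finitely supported functions as free modules\<close>

definition scale :: "'k::comm_ring_1 \<Rightarrow> ('b \<Rightarrow>\<^sub>0 'k) \<Rightarrow> ('b \<Rightarrow>\<^sub>0 'k)" where
  "scale c f = Poly_Mapping.map ((*) c) f"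

lemma lookup_scale [simp]: "Poly_Mapping.lookup (scale c f) k = c * Poly_Mapping.lookup f k"
  by (simp add: scale_def Poly_Mapping.map.rep_eq when_def)

global_interpretation free_module: vector_space "scale :: 'k::field \<Rightarrow> ('b \<Rightarrow>\<^sub>0 'k) \<Rightarrow> ('b \<Rightarrow>\<^sub>0 'k)"
  by standard (auto intro!: poly_mapping_eqI simp: lookup_add algebra_simps)

lemma scale_single: "scale c (Poly_Mapping.single k d) = Poly_Mapping.single k (c * d)"
  by (rule poly_mapping_eqI) (simp add: lookup_single when_def)

lemma scale_simps:
  fixes c :: "'k::comm_ring_1"
  shows "scale c (f + g) = scale c f + scale c g" "scale c (scale d f) = scale (c * d) f"
    "scale 1 f = f" "scale 0 f = 0" "scale c 0 = 0" "scale (c + d) f = scale c f + scale d f"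
    "scale c (f - g) = scale c f - scale c g"
  by (rule poly_mapping_eqI; simp add: lookup_add lookup_minus algebra_simps)+

lemma scale_sum: "scale (c::'k::comm_ring_1) (sum f S) = (\<Sum>i\<in>S. scale c (f i))"
  by (induction S rule: infinite_finite_induct) (auto simp: scale_simps)

definition lin_ext :: "('a \<Rightarrow> ('b \<Rightarrow>\<^sub>0 'k)) \<Rightarrow> ('a \<Rightarrow>\<^sub>0 'k::comm_ring_1) \<Rightarrow> ('b \<Rightarrow>\<^sub>0 'k)" where
  "lin_ext g f = (\<Sum>k\<in>Poly_Mapping.keys f. scale (Poly_Mapping.lookup f k) (g k))"

lemma lin_ext_superset:
  assumes "finite S" "Poly_Mapping.keys f \<subseteq> S"
  shows "lin_ext g f = (\<Sum>k\<in>S. scale (Poly_Mapping.lookup f k) (g k))"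
  unfolding lin_ext_def
  by (rule sum.mono_neutral_left) (use assms in \<open>auto simp: in_keys_iff scale_simps\<close>)

lemma lin_ext_add: "lin_ext g (f + f') = lin_ext g f + lin_ext g f'"
proof -
  let ?S = "Poly_Mapping.keys f \<union> Poly_Mapping.keys f'"
  have "Poly_Mapping.keys (f + f') \<subseteq> ?S" by (rule Poly_Mapping.keys_add)
  then show ?thesis
    by (simp add: lin_ext_superset[of ?S] lookup_add scale_simps sum.distrib)
qed

lemma lin_ext_scale: "lin_ext g (scale c f) = scale c (lin_ext g f)"
proof -
  have "Poly_Mapping.keys (scale c f) \<subseteq> Poly_Mapping.keys f" by (auto simp: in_keys_iff)
  then show ?thesis
    by (simp add: lin_ext_superset[of "Poly_Mapping.keys f"] scale_sum scale_simps)
qed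

lemma lin_ext_single [simp]: "lin_ext g (Poly_Mapping.single k c) = scale c (g k)"
  by (cases "c = 0") (auto simp: lin_ext_def scale_simps)

lemma lin_ext_zero [simp]: "lin_ext g 0 = 0"
  by (simp add: lin_ext_def)

lemma free_module_induct [case_names zero single add]:
  fixes f :: "'a \<Rightarrow>\<^sub>0 'k::comm_ring_1"
  assumes "P 0" "\<And>k c. P (Poly_Mapping.single k c)" "\<And>f g. P f \<Longrightarrow> P g \<Longrightarrow> P (f + g)"
  shows "P f"
proof -
  have "f = (\<Sum>k\<in>Poly_Mapping.keys f. Poly_Mapping.single k (Poly_Mapping.lookup f k))"
    by (rule poly_mapping_eqI) (auto simp: lookup_sum lookup_single when_def sum.delta in_keys_iff)
  moreover have "P (\<Sum>k\<in>S. Poly_Mapping.single k (Poly_Mapping.lookup f k))" if "finite S" for S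
    using that by induction (auto intro: assms)
  ultimately show ?thesis by (metis finite_keys)
qed

section \<open>The mod p Steenrod algebra\<close>

datatype steenrod_gen = Bockstein | Power nat

datatype steenrod_word = Word (letters: "steenrod_gen list")

instantiation steenrod_word :: monoid_add
begin
definition "0 = Word []"
definition "v + w = Word (letters v @ letters w)"
instance by standard (auto simp: zero_steenrod_word_def plus_steenrod_word_def)
end

type_synonym 'p free_steenrod = "steenrod_word \<Rightarrow>\<^sub>0 'p mod_ring"

abbreviation bock :: "'p::prime_card free_steenrod" where
  "bock \<equiv> Poly_Mapping.single (Word [Bockstein]) 1"

abbreviation rpow :: "nat \<Rightarrow> 'p::prime_card free_steenrod" where
  "rpow i \<equiv> Poly_Mapping.single (Word [Power i]) 1"

text \<open>
  Defining relators: \<open>P^0 = 1\<close>, \<open>beta^2 = 0\<close> and the two families of Adem relations, for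
  \<open>a < p b\<close> and \<open>a \<le> p b\<close>.  In the summation ranges all natural number subtractions are exact;
  the strict bound \<open>p i < a\<close> in the last sum drops only a binomial with lower index \<open>-1\<close>, which
  counts as \<open>0\<close>.  The sign \<open>(-1)^(a+i-1)\<close> of that sum is written as the minus in front of it.
\<close>

inductive_set steenrod_relators :: "'p::prime_card free_steenrod set" where
  "rpow 0 - 1 \<in> steenrod_relators"
| "bock * bock \<in> steenrod_relators"
| "a < CARD('p) * b \<Longrightarrow>
    rpow a * rpow b
    - (\<Sum>i | CARD('p) * i \<le> a.
         (-1) ^ (a + i) * of_nat (((CARD('p) - 1) * (b - i) - 1) choose (a - CARD('p) * i))
         * (rpow (a + b - i) * rpow i))
    \<in> (steenrod_relators :: 'p free_steenrod set)"
| "a \<le> CARD('p) * b \<Longrightarrow>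
    rpow a * bock * rpow b
    - ((\<Sum>i | CARD('p) * i \<le> a.
          (-1) ^ (a + i) * of_nat (((CARD('p) - 1) * (b - i)) choose (a - CARD('p) * i))
          * (bock * rpow (a + b - i) * rpow i))
      - (\<Sum>i | CARD('p) * i < a.
          (-1) ^ (a + i) * of_nat (((CARD('p) - 1) * (b - i) - 1) choose (a - CARD('p) * i - 1))
          * (rpow (a + b - i) * bock * rpow i)))
    \<in> (steenrod_relators :: 'p free_steenrod set)"

inductive_set steenrod_ideal :: "'p::prime_card free_steenrod set" where
  relator: "f \<in> steenrod_relators \<Longrightarrow> f \<in> steenrod_ideal"
| zero: "0 \<in> steenrod_ideal"
| diff: "f \<in> steenrod_ideal \<Longrightarrow> g \<in> steenrod_ideal \<Longrightarrow> f - g \<in> steenrod_ideal"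
| left_mult: "f \<in> steenrod_ideal \<Longrightarrow> g * f \<in> steenrod_ideal"
| right_mult: "f \<in> steenrod_ideal \<Longrightarrow> f * g \<in> steenrod_ideal"

lemma steenrod_ideal_uminus: "f \<in> steenrod_ideal \<Longrightarrow> - f \<in> steenrod_ideal"
  using steenrod_ideal.diff[OF steenrod_ideal.zero] by fastforce

lemma steenrod_ideal_add: "f \<in> steenrod_ideal \<Longrightarrow> g \<in> steenrod_ideal \<Longrightarrow> f + g \<in> steenrod_ideal"
  using steenrod_ideal.diff[of f "- g"] steenrod_ideal_uminus[of g] by simp

definition steenrod_cong :: "'p::prime_card free_steenrod \<Rightarrow> 'p free_steenrod \<Rightarrow> bool" where
  "steenrod_cong f g \<longleftrightarrow> f - g \<in> steenrod_ideal"

lemma steenrod_cong_equivp: "equivp (steenrod_cong :: 'p::prime_card free_steenrod \<Rightarrow> _)"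
proof (rule equivpI)
  show "reflp (steenrod_cong :: 'p free_steenrod \<Rightarrow> _)"
    by (auto simp: reflp_def steenrod_cong_def intro: steenrod_ideal.zero)
  show "symp (steenrod_cong :: 'p free_steenrod \<Rightarrow> _)"
    unfolding symp_def steenrod_cong_def using steenrod_ideal_uminus by fastforce
  show "transp (steenrod_cong :: 'p free_steenrod \<Rightarrow> _)"
    unfolding transp_def steenrod_cong_def
  proof (intro allI impI)
    fix x y z :: "'p free_steenrod"
    assume "x - y \<in> steenrod_ideal" "y - z \<in> steenrod_ideal"
    then have "(x - y) + (y - z) \<in> steenrod_ideal" by (rule steenrod_ideal_add)
    then show "x - z \<in> steenrod_ideal" by simp
  qed
qed

quotient_type 'p steenrod = "'p::prime_card free_steenrod" / steenrod_cong
  by (rule steenrod_cong_equivp)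

subsection \<open>Augmentation\<close>

text \<open>
  The augmentation sends \<open>P^0\<close> to 1 and the Bockstein and \<open>P^i\<close> for \<open>i > 0\<close> to 0; its kernel
  is the ideal of elements of positive degree.
\<close>

definition free_augmentation :: "'p::prime_card free_steenrod \<Rightarrow> 'p mod_ring" where
  "free_augmentation f = (\<Sum>w\<in>Poly_Mapping.keys f.
     Poly_Mapping.lookup f w * of_bool (set (letters w) \<subseteq> {Power 0}))"

lemma free_augmentation_add:
  "free_augmentation (f + g) = free_augmentation f + free_augmentation g"
proof -
  have *: "free_augmentation h = (\<Sum>w\<in>S. Poly_Mapping.lookup h w * of_bool (set (letters w) \<subseteq> {Power 0}))"
    if "finite S" "Poly_Mapping.keys h \<subseteq> S" for S and h :: "'a free_steenrod"
    unfolding free_augmentation_def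
    by (rule sum.mono_neutral_left) (use that in \<open>auto simp: in_keys_iff\<close>)
  let ?S = "Poly_Mapping.keys f \<union> Poly_Mapping.keys g"
  have "Poly_Mapping.keys (f + g) \<subseteq> ?S" by (rule Poly_Mapping.keys_add)
  then show ?thesis
    by (simp add: *[of ?S] lookup_add sum.distrib distrib_right)
qed

lemma free_augmentation_single:
  "free_augmentation (Poly_Mapping.single w c) = c * of_bool (set (letters w) \<subseteq> {Power 0})"
  by (cases "c = 0") (auto simp: free_augmentation_def)

lemma free_augmentation_zero [simp]: "free_augmentation 0 = 0"
  by (simp add: free_augmentation_def)

lemma free_augmentation_diff:
  "free_augmentation (f - g) = free_augmentation f - free_augmentation g"
  using free_augmentation_add[of "f - g" g] by simp

lemma free_augmentation_sum: "free_augmentation (sum f S) = (\<Sum>i\<in>S. free_augmentation (f i))"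
  by (induction S rule: infinite_finite_induct) (auto simp: free_augmentation_add)

lemma free_augmentation_one [simp]: "free_augmentation 1 = 1"
  using free_augmentation_single[of 0 1] by (simp add: zero_steenrod_word_def flip: single_one)

lemma free_augmentation_mult:
  "free_augmentation (f * g) = free_augmentation f * free_augmentation g"
proof (induction f rule: free_module_induct)
  case (single k c)
  show ?case
    by (induction g rule: free_module_induct)
      (auto simp: mult_single free_augmentation_single plus_steenrod_word_def
        distrib_left free_augmentation_add)
qed (auto simp: distrib_right free_augmentation_add)

lemma free_augmentation_sum_zero:
  assumes "\<And>i. i \<in> S \<Longrightarrow> free_augmentation (g i) = 0"
  shows "free_augmentation (\<Sum>i\<in>S. c i * g i) = 0"
  unfolding free_augmentation_sum free_augmentation_mult
  by (rule sum.neutral) (simp add: assms)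

lemma free_augmentation_diff_zero:
  "free_augmentation f = 0 \<Longrightarrow> free_augmentation g = 0 \<Longrightarrow> free_augmentation (f - g) = 0"
  by (simp add: free_augmentation_diff)

lemma free_augmentation_relators: "f \<in> steenrod_relators \<Longrightarrow> free_augmentation f = 0"
proof (induction rule: steenrod_relators.induct)
  case 1
  show ?case by (simp add: free_augmentation_diff free_augmentation_single)
next
  case 2
  show ?case by (simp add: free_augmentation_mult free_augmentation_single)
next
  case (3 a b)
  then have b: "b > 0" by (cases b) auto
  show ?case
    by (intro free_augmentation_diff_zero free_augmentation_sum_zero)
      (use b in \<open>auto simp: free_augmentation_mult free_augmentation_single\<close>)
next
  case (4 a b)
  show ?case
    by (intro free_augmentation_diff_zero free_augmentation_sum_zero)
      (auto simp: free_augmentation_mult free_augmentation_single)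
qed

lemma free_augmentation_ideal: "f \<in> steenrod_ideal \<Longrightarrow> free_augmentation f = 0"
  by (induction rule: steenrod_ideal.induct)
    (auto simp: free_augmentation_relators free_augmentation_diff free_augmentation_mult)

lift_definition augmentation :: "'p::prime_card steenrod \<Rightarrow> 'p mod_ring" is free_augmentation
  unfolding steenrod_cong_def
  by (drule free_augmentation_ideal) (simp add: free_augmentation_diff)

instantiation steenrod :: (prime_card) ring_1
begin

lift_definition zero_steenrod :: "'a steenrod" is 0 .
lift_definition one_steenrod :: "'a steenrod" is 1 .
lift_definition plus_steenrod :: "'a steenrod \<Rightarrow> 'a steenrod \<Rightarrow> 'a steenrod" is "(+)"
proof -
  fix f f' g g' :: "'a free_steenrod"
  assume "steenrod_cong f f'" "steenrod_cong g g'"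
  then have "(f - f') + (g - g') \<in> steenrod_ideal"
    unfolding steenrod_cong_def by (intro steenrod_ideal_add)
  then show "steenrod_cong (f + g) (f' + g')"
    unfolding steenrod_cong_def by (simp only: add_diff_add)
qed
lift_definition uminus_steenrod :: "'a steenrod \<Rightarrow> 'a steenrod" is uminus
proof -
  fix f f' :: "'a free_steenrod"
  assume "steenrod_cong f f'"
  then have "- (f - f') \<in> steenrod_ideal"
    unfolding steenrod_cong_def by (rule steenrod_ideal_uminus)
  then show "steenrod_cong (- f) (- f')"
    unfolding steenrod_cong_def by (simp only: minus_diff_minus)
qed
definition minus_steenrod :: "'a steenrod \<Rightarrow> 'a steenrod \<Rightarrow> 'a steenrod" where
  "minus_steenrod a b = a + - b"
lift_definition times_steenrod :: "'a steenrod \<Rightarrow> 'a steenrod \<Rightarrow> 'a steenrod" is "(*)"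
proof -
  fix f f' g g' :: "'a free_steenrod"
  assume "steenrod_cong f f'" "steenrod_cong g g'"
  then have "(f - f') * g + f' * (g - g') \<in> steenrod_ideal"
    unfolding steenrod_cong_def
    by (intro steenrod_ideal_add steenrod_ideal.left_mult steenrod_ideal.right_mult)
  then show "steenrod_cong (f * g) (f' * g')"
    unfolding steenrod_cong_def by (simp add: algebra_simps)
qed

instance
proof
  have cong: "f = g \<Longrightarrow> steenrod_cong f g" for f g :: "'a free_steenrod"
    by (simp add: steenrod_cong_def steenrod_ideal.zero)
  fix a b c :: "'a steenrod"
  show "a * b * c = a * (b * c)" by transfer (rule cong, simp add: mult.assoc)
  show "1 * a = a" "a * 1 = a" by (transfer, rule cong, simp)+
  show "(a + b) * c = a * c + b * c" by transfer (rule cong, simp add: distrib_right)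
  show "a * (b + c) = a * b + a * c" by transfer (rule cong, simp add: distrib_left)
  show "a + b + c = a + (b + c)" by transfer (rule cong, simp add: add.assoc)
  show "a + b = b + a" by transfer (rule cong, simp add: add.commute)
  show "0 + a = a" "- a + a = 0" by (transfer, rule cong, simp)+
  show "a - b = a + - b" by (rule minus_steenrod_def)
  show "0 \<noteq> (1 :: 'a steenrod)"
  proof
    assume "0 = (1 :: 'a steenrod)"
    then have "augmentation 0 = augmentation (1 :: 'a steenrod)" by simp
    then show False by transfer simp
  qed
qed

end

lemma augmentation_simps [simp]:
  "augmentation 0 = 0" "augmentation 1 = 1"
  "augmentation (a + b) = augmentation a + augmentation b"
  "augmentation (a * b) = augmentation a * augmentation b"
  by (transfer; simp add: free_augmentation_add free_augmentation_mult)+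

lemma augmentation_diff [simp]: "augmentation (a - b) = augmentation a - augmentation b"
  using augmentation_simps(3)[of "a - b" b] by (simp del: augmentation_simps)

definition augmentation_ideal :: "'p::prime_card steenrod set" where
  "augmentation_ideal = {a. augmentation a = 0}"

section \<open>The cohomology of the classifying space of the cyclic group of order p\<close>

text \<open>
  The index \<open>(e, t)\<close> stands for the basis element \<open>x^e y^t\<close> of the unreduced cohomology
  \<open>E(x) \<otimes> F_p[y]\<close> (\<open>True\<close> is exponent 1), and for its dual \<open>a^e b^[t]\<close> in homology.
  The reduced cohomology \<open>P\<close> consists of the elements without constant term.
\<close>

type_synonym basis_index = "bool \<times> nat"

definition basis_deg :: "basis_index \<Rightarrow> nat" where
  "basis_deg m = 2 * snd m + of_bool (fst m)"

type_synonym 'p cohomology = "basis_index \<Rightarrow>\<^sub>0 'p mod_ring"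

definition reduced :: "'p::prime_card cohomology set" where
  "reduced = {u. Poly_Mapping.lookup u (False, 0) = 0}"

text \<open>
  The action on the basis, as forced by \<open>beta x = y\<close>, the derivation property of the Bockstein,
  \<open>P^0 = id\<close>, \<open>P^1 y = y^p\<close>, \<open>P^i y = 0\<close> for \<open>i > 1\<close>, \<open>P^i x = 0\<close> for \<open>i > 0\<close> and the Cartan
  formula: \<open>beta (x^e y^t) = e y^(t+1)\<close> and \<open>P^i (x^e y^t) = (t choose i) x^e y^(t + i(p-1))\<close>.
\<close>

fun gen_act_basis :: "steenrod_gen \<Rightarrow> basis_index \<Rightarrow> 'p::prime_card cohomology" where
  "gen_act_basis Bockstein (e, t) = (if e then Poly_Mapping.single (False, t + 1) 1 else 0)"
| "gen_act_basis (Power i) (e, t) =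
     Poly_Mapping.single (e, t + i * (CARD('p) - 1)) (of_nat (t choose i))"

definition gen_act :: "steenrod_gen \<Rightarrow> 'p::prime_card cohomology \<Rightarrow> 'p cohomology" where
  "gen_act g = lin_ext (gen_act_basis g)"

definition word_act :: "steenrod_word \<Rightarrow> 'p::prime_card cohomology \<Rightarrow> 'p cohomology" where
  "word_act w u = foldr gen_act (letters w) u"

definition free_act :: "'p::prime_card free_steenrod \<Rightarrow> 'p cohomology \<Rightarrow> 'p cohomology" where
  "free_act f u = lin_ext (\<lambda>w. word_act w u) f"

lemma word_act_linear:
  "word_act w 0 = 0" "word_act w (u + v) = word_act w u + word_act w v"
  "word_act w (scale c u) = scale c (word_act w u)"
proof -
  have "foldr gen_act gs 0 = 0"
    "foldr gen_act gs (u + v) = foldr gen_act gs u + foldr gen_act gs v"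
    "foldr gen_act gs (scale c u) = scale c (foldr gen_act gs u)" for gs
    by (induction gs) (auto simp: gen_act_def lin_ext_add lin_ext_scale)
  then show "word_act w 0 = 0" "word_act w (u + v) = word_act w u + word_act w v"
    "word_act w (scale c u) = scale c (word_act w u)"
    by (auto simp: word_act_def)
qed

lemma word_act_mult: "word_act (v + w) u = word_act v (word_act w u)"
  by (simp add: word_act_def plus_steenrod_word_def)

lemma free_act_left:
  "free_act 0 u = 0" "free_act (f + g) u = free_act f u + free_act g u"
  "free_act (Poly_Mapping.single w c) u = scale c (word_act w u)"
  by (auto simp: free_act_def lin_ext_add)

lemma free_act_diff: "free_act (f - g) u = free_act f u - free_act g u"
  using free_act_left(2)[of "f - g" g u] by simp

lemma free_act_sum: "free_act (sum f S) u = (\<Sum>i\<in>S. free_act (f i) u)"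
  by (induction S rule: infinite_finite_induct) (auto simp: free_act_left)

lemma free_act_right:
  "free_act f 0 = 0" "free_act f (u + v) = free_act f u + free_act f v"
  "free_act f (scale c u) = scale c (free_act f u)"
  by (auto simp: free_act_def lin_ext_def word_act_linear scale_simps sum.distrib scale_sum mult.commute)

lemma free_act_one: "free_act 1 u = u"
  using free_act_left(3)[of 0 1 u] by (simp add: word_act_def zero_steenrod_word_def scale_simps flip: single_one)

lemma free_act_mult: "free_act (f * g) u = free_act f (free_act g u)"
proof (induction f rule: free_module_induct)
  case (single k c)
  show ?case
    by (induction g rule: free_module_induct)
      (auto simp: mult_single free_act_left word_act_mult word_act_linear scale_simps distrib_left)
qed (auto simp: distrib_right free_act_left)

lemma free_act_gens:
  "free_act bock u = gen_act Bockstein u" "free_act (rpow i) u = gen_act (Power i) u"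
  by (auto simp: free_act_left word_act_def scale_simps)

lemma free_act_coeff:
  "free_act ((-1) ^ j * of_nat m * f) u = scale ((-1) ^ j * of_nat m) (free_act f u)"
proof -
  have 1: "free_act (of_nat m) v = scale (of_nat m) v" for v :: "'a cohomology"
    by (induction m) (auto simp: free_act_left free_act_one scale_simps)
  have 2: "free_act ((-1) ^ j) v = scale ((-1) ^ j) v" for v :: "'a cohomology"
  proof (induction j)
    case 0 then show ?case by (simp add: free_act_one scale_simps)
  next
    case (Suc j)
    have m: "free_act (- 1) w = - w" for w :: "'a cohomology"
      using free_act_diff[of 0 1 w] by (simp add: free_act_left free_act_one)
    have s: "scale (- c) w = - scale c w" for c and w :: "'a cohomology"
      by (rule poly_mapping_eqI) simp
    show ?case by (simp only: power_Suc free_act_mult Suc m) (simp add: s)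
  qed
  show ?thesis by (simp only: free_act_mult 1 2 scale_simps)
qed

lemma gen_act_single:
  "gen_act Bockstein (Poly_Mapping.single (e, t) c :: 'p::prime_card cohomology)
     = (if e then Poly_Mapping.single (False, t + 1) c else 0)"
  "gen_act (Power i) (Poly_Mapping.single (e, t) c :: 'p::prime_card cohomology)
     = Poly_Mapping.single (e, t + i * (CARD('p) - 1)) (c * of_nat (t choose i))"
  by (auto simp: gen_act_def scale_single scale_simps)

lemma diff3_zero: "x = 0 \<Longrightarrow> y = 0 \<Longrightarrow> z = 0 \<Longrightarrow> x - (y - z) = (0 :: 'x::ab_group_add)"
  by simp

lemma single_sum: "Poly_Mapping.single k (sum f S) = (\<Sum>i\<in>S. Poly_Mapping.single k (f i))"
  by (induction S rule: infinite_finite_induct) (auto simp: single_add)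

lemma free_act_relators: "f \<in> steenrod_relators \<Longrightarrow> free_act f u = 0"
proof -
  assume f: "f \<in> steenrod_relators"
  have basis: "free_act f (Poly_Mapping.single (e, n) 1) = 0" for e n
    using f
  proof (induction rule: steenrod_relators.induct)
    case 1
    show ?case by (simp add: free_act_diff free_act_gens free_act_one gen_act_single)
  next
    case 2
    show ?case by (simp add: free_act_mult free_act_gens gen_act_single) (simp add: gen_act_def)
  next
    case (3 a b)
    let ?p = "CARD('a)"
    let ?k = "(e, n + (a + b) * (?p - 1))"
    have idx: "n + i * (?p - 1) + (a + b - i) * (?p - 1) = n + (a + b) * (?p - 1)" if "?p * i \<le> a" for i
    proof -
      have "i \<le> ?p * i" by simp
      then have "i \<le> a + b" using that by linarith
      then have "i * (?p - 1) + (a + b - i) * (?p - 1) = (a + b) * (?p - 1)"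
        by (simp flip: add_mult_distrib)
      then show ?thesis by simp
    qed
    have L: "free_act (rpow a * rpow b) (Poly_Mapping.single (e, n) 1 :: 'a cohomology)
      = Poly_Mapping.single ?k (of_nat ((n choose b) * ((n + b * (?p - 1)) choose a)))"
      by (simp add: free_act_mult free_act_gens gen_act_single distrib_right add_ac)
    have R: "free_act ((-1) ^ (a + i) * of_nat ((((?p - 1) * (b - i) - 1) choose (a - ?p * i)))
         * (rpow (a + b - i) * rpow i)) (Poly_Mapping.single (e, n) 1 :: 'a cohomology)
       = Poly_Mapping.single ?k ((-1) ^ (a + i) * of_nat (((?p - 1) * (b - i) - 1) choose (a - ?p * i))
           * (of_nat ((n choose i) * ((n + i * (?p - 1)) choose (a + b - i)))))"
      if "?p * i \<le> a" for i
      using idx[OF that]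
      by (simp only: free_act_coeff free_act_mult[of "rpow _"] free_act_gens gen_act_single scale_single)
        (simp add: mult_ac)
    show ?case
      unfolding free_act_diff free_act_sum L adem_binomial1[OF 3]
        single_sum right_minus_eq
      by (rule sum.cong[OF refl]) (simp only: R mem_Collect_eq)
  next
    case (4 a b)
    let ?p = "CARD('a)"
    let ?k = "(False, n + 1 + (a + b) * (?p - 1))"
    have idx: "n + i * (?p - 1) + (a + b - i) * (?p - 1) = n + (a + b) * (?p - 1)" if "?p * i \<le> a" for i
    proof -
      have "i \<le> ?p * i" by simp
      then have "i \<le> a + b" using that by linarith
      then have "i * (?p - 1) + (a + b - i) * (?p - 1) = (a + b) * (?p - 1)"
        by (simp flip: add_mult_distrib)
      then show ?thesis by simp
    qed
    have L: "free_act (rpow a * bock * rpow b) (Poly_Mapping.single (e, n) 1 :: 'a cohomology)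
      = (if e then Poly_Mapping.single ?k (of_nat ((n choose b) * ((n + 1 + b * (?p - 1)) choose a))) else 0)"
      by (simp add: free_act_mult free_act_gens gen_act_single distrib_right add_ac) (simp add: gen_act_def)
    have R1: "free_act ((-1) ^ (a + i) * of_nat ((((?p - 1) * (b - i)) choose (a - ?p * i)))
         * (bock * rpow (a + b - i) * rpow i)) (Poly_Mapping.single (e, n) 1 :: 'a cohomology)
       = (if e then Poly_Mapping.single ?k ((-1) ^ (a + i) * of_nat (((?p - 1) * (b - i)) choose (a - ?p * i))
           * (of_nat ((n choose i) * ((n + i * (?p - 1)) choose (a + b - i))))) else 0)"
      if "?p * i \<le> a" for i
      using idx[OF that]
      by (simp only: free_act_coeff free_act_mult[of "rpow _"] free_act_mult[of bock] free_act_mult[of "bock * _"] free_act_gens gen_act_single scale_single)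
        (simp add: mult_ac scale_single scale_simps)
    have R2: "free_act ((-1) ^ (a + i) * of_nat ((((?p - 1) * (b - i) - 1) choose (a - ?p * i - 1)))
         * (rpow (a + b - i) * bock * rpow i)) (Poly_Mapping.single (e, n) 1 :: 'a cohomology)
       = (if e then Poly_Mapping.single ?k ((-1) ^ (a + i) * of_nat (((?p - 1) * (b - i) - 1) choose (a - ?p * i - 1))
           * (of_nat ((n choose i) * ((n + 1 + i * (?p - 1)) choose (a + b - i))))) else 0)"
      if "?p * i < a" for i
    proof (cases e)
      case True
      have idx': "n + i * (?p - 1) + 1 + (a + b - i) * (?p - 1) = n + 1 + (a + b) * (?p - 1)"
        using idx[of i] that by linarith
      show ?thesis
        unfolding if_P[OF True]
        by (simp only: free_act_coeff free_act_mult[of "rpow _"] free_act_mult[of bock] free_act_mult[of "rpow _ * _"]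
            free_act_gens gen_act_single if_P[OF True] idx' scale_single)
          (simp add: mult_ac)
    next
      case False
      then show ?thesis
        by (simp only: free_act_coeff free_act_mult[of "rpow _"] free_act_mult[of bock] free_act_mult[of "rpow _ * _"] free_act_gens gen_act_single scale_single)
          (simp add: gen_act_def scale_simps)
    qed
    show ?case
    proof (cases e)
      case True
      show ?thesis
        unfolding free_act_diff free_act_sum L adem_binomial2[OF 4]
          single_diff single_sum right_minus_eq if_P[OF True]
        by (intro arg_cong2[where f = "(-)"] sum.cong refl; simp only: R1 R2 mem_Collect_eq if_P[OF True])
    next
      case False
      show ?thesis
        unfolding free_act_diff free_act_sum L
      proof (intro diff3_zero sum.neutral ballI, goal_cases)
        case 1 show ?case by (simp add: False)
      next
        case (2 i) show ?case by (rule trans[OF R1]) (use 2 False in auto)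
      next
        case (3 i) show ?case by (rule trans[OF R2]) (use 3 False in auto)
      qed
    qed
  qed
  show ?thesis
  proof (induction u rule: free_module_induct)
    case (single k c)
    have "Poly_Mapping.single k c = scale c (Poly_Mapping.single k 1)" by (simp add: scale_single)
    then show ?case using basis by (cases k) (simp add: free_act_right scale_simps)
  qed (auto simp: free_act_right)
qed

lemma free_act_ideal: "f \<in> steenrod_ideal \<Longrightarrow> free_act f u = 0"
  by (induction arbitrary: u rule: steenrod_ideal.induct)
    (auto simp: free_act_relators free_act_left free_act_diff free_act_mult free_act_right)

text \<open>The action respects the Adem relations, hence descends to the Steenrod algebra.\<close>

lift_definition act :: "'p::prime_card steenrod \<Rightarrow> 'p cohomology \<Rightarrow> 'p cohomology" is free_act
  unfolding steenrod_cong_def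
  by (rule ext, drule free_act_ideal) (simp add: free_act_diff)

lemma act_simps:
  "act 0 u = 0" "act 1 u = u" "act (a + b) u = act a u + act b u"
  "act (a * b) u = act a (act b u)"
  "act a 0 = 0" "act a (u + v) = act a u + act a v" "act a (scale c u) = scale c (act a u)"
  by (transfer; simp add: free_act_left free_act_one free_act_mult free_act_right)+

lift_definition bockstein :: "'p::prime_card steenrod" is bock .
lift_definition reduced_power :: "nat \<Rightarrow> 'p::prime_card steenrod" is rpow .

lemma act_bockstein:
  "act bockstein (Poly_Mapping.single (e, t) c :: 'p::prime_card cohomology)
     = (if e then Poly_Mapping.single (False, t + 1) c else 0)"
  by (simp add: bockstein_def act.abs_eq free_act_gens gen_act_single)

lemma act_reduced_power:
  "act (reduced_power i) (Poly_Mapping.single (e, t) c :: 'p::prime_card cohomology)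
     = Poly_Mapping.single (e, t + i * (CARD('p) - 1)) (c * of_nat (t choose i))"
  by (simp add: reduced_power_def act.abs_eq free_act_gens gen_act_single)

lemma augmentation_gens:
  "augmentation bockstein = 0" "augmentation (reduced_power i) = of_bool (i = 0)"
  by (simp_all add: bockstein_def reduced_power_def augmentation.abs_eq free_augmentation_single)

lemma act_diff: "act (a - b) u = act a u - act b u"
  using act_simps(3)[of "a - b" b u] by simp

lemma keys_lin_ext:
  assumes "m \<in> Poly_Mapping.keys (lin_ext g f)"
  shows "\<exists>k\<in>Poly_Mapping.keys f. m \<in> Poly_Mapping.keys (g k)"
proof (rule ccontr)
  assume "\<not> ?thesis"
  then have "Poly_Mapping.lookup (g k) m = 0" if "k \<in> Poly_Mapping.keys f" for k
    using that by (auto simp: in_keys_iff)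
  then have "Poly_Mapping.lookup (lin_ext g f) m = 0"
    by (simp add: lin_ext_def lookup_sum)
  then show False using assms by (simp add: in_keys_iff)
qed

lemma act_degree:
  assumes "m \<in> Poly_Mapping.keys (act a u)"
  obtains k where "k \<in> Poly_Mapping.keys u" "basis_deg k \<le> basis_deg m"
proof -
  have gen: "\<exists>k\<in>Poly_Mapping.keys v. basis_deg k \<le> basis_deg m" if m: "m \<in> Poly_Mapping.keys (gen_act g v)"
    for g m and v :: "'a cohomology"
  proof -
    obtain k where k: "k \<in> Poly_Mapping.keys v" "m \<in> Poly_Mapping.keys (gen_act_basis g k :: 'a cohomology)"
      using keys_lin_ext[OF m[unfolded gen_act_def]] by blast
    then have "basis_deg k \<le> basis_deg m"
      by (cases k; cases g) (auto simp: basis_deg_def split: if_splits)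
    with k show ?thesis by blast
  qed
  have word: "\<exists>k\<in>Poly_Mapping.keys u. basis_deg k \<le> basis_deg m" if "m \<in> Poly_Mapping.keys (foldr gen_act gs u)" for gs m
    using that
  proof (induction gs arbitrary: m)
    case (Cons g gs)
    then obtain k where k: "k \<in> Poly_Mapping.keys (foldr gen_act gs u)" "basis_deg k \<le> basis_deg m"
      using gen[of m g "foldr gen_act gs u"] by auto
    obtain k' where "k' \<in> Poly_Mapping.keys u" "basis_deg k' \<le> basis_deg k" using Cons.IH[OF k(1)] by blast
    with k(2) show ?case by (intro bexI[of _ k']) auto
  qed auto
  have "\<exists>k\<in>Poly_Mapping.keys u. basis_deg k \<le> basis_deg m"
    using assms
  proof (induction a rule: steenrod.abs_induct)
    case (1 f)
    then have "m \<in> Poly_Mapping.keys (lin_ext (\<lambda>w. word_act w u) f)"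
      by (simp add: act.abs_eq free_act_def)
    from keys_lin_ext[OF this] obtain w where "m \<in> Poly_Mapping.keys (word_act w u)" by blast
    then show ?case unfolding word_act_def by (rule word)
  qed
  then show ?thesis using that by blast
qed

section \<open>Homology\<close>

type_synonym 'p homology = "basis_index \<Rightarrow>\<^sub>0 'p mod_ring"

definition dual_basis :: "bool \<Rightarrow> nat \<Rightarrow> 'p::prime_card homology" where
  "dual_basis e t = Poly_Mapping.single (e, t) 1"

definition pairing :: "'p::prime_card homology \<Rightarrow> 'p cohomology \<Rightarrow> 'p mod_ring" where
  "pairing h u = (\<Sum>m\<in>Poly_Mapping.keys u. Poly_Mapping.lookup h m * Poly_Mapping.lookup u m)"

text \<open>The degree \<open>t\<close> part \<open>H_t\<close> of the reduced homology.\<close>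

definition reduced_homology :: "nat \<Rightarrow> 'p::prime_card homology set" where
  "reduced_homology t = {h. \<forall>m\<in>Poly_Mapping.keys h. m \<noteq> (False, 0) \<and> basis_deg m = t}"

text \<open>
  The dual right action, characterised by \<open>pairing_right_act\<close> below: \<open>\<langle>h a, u\<rangle> = \<langle>h, a u\<rangle>\<close>.
\<close>

definition right_act :: "'p::prime_card homology \<Rightarrow> 'p steenrod \<Rightarrow> 'p homology" where
  "right_act h a = Abs_poly_mapping (\<lambda>m. pairing h (act a (Poly_Mapping.single m 1)))"

lemma pairing_superset:
  assumes "finite S" "Poly_Mapping.keys u \<subseteq> S"
  shows "pairing h u = (\<Sum>m\<in>S. Poly_Mapping.lookup h m * Poly_Mapping.lookup u m)"
  unfolding pairing_def
  by (rule sum.mono_neutral_left) (use assms in \<open>auto simp: in_keys_iff\<close>)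

lemma pairing_add: "pairing h (u + v) = pairing h u + pairing h v"
proof -
  let ?S = "Poly_Mapping.keys u \<union> Poly_Mapping.keys v"
  have "Poly_Mapping.keys (u + v) \<subseteq> ?S" by (rule Poly_Mapping.keys_add)
  then show ?thesis
    by (simp add: pairing_superset[of ?S] lookup_add sum.distrib distrib_left)
qed

lemma pairing_zero [simp]: "pairing h 0 = 0" "pairing 0 u = 0"
  by (auto simp: pairing_def)

lemma pairing_diff: "pairing h (u - v) = pairing h u - pairing h v"
  using pairing_add[of h "u - v" v] by simp

lemma pairing_scale: "pairing h (scale c u) = c * pairing h u"
proof -
  have "Poly_Mapping.keys (scale c u) \<subseteq> Poly_Mapping.keys u" by (auto simp: in_keys_iff)
  then show ?thesis
    by (simp add: pairing_superset[of "Poly_Mapping.keys u"] sum_distrib_left mult_ac)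
qed

lemma pairing_single: "pairing h (Poly_Mapping.single m c) = Poly_Mapping.lookup h m * c"
  by (cases "c = 0") (auto simp: pairing_def)

lemma pairing_dual_basis:
  "pairing (dual_basis e t) (Poly_Mapping.single (e', t') 1) = of_bool (e = e' \<and> t = t')"
  by (simp add: pairing_single dual_basis_def lookup_single when_def)

lemma lookup_right_act:
  "Poly_Mapping.lookup (right_act h a) m = pairing h (act a (Poly_Mapping.single m 1))"
proof -
  have "finite {m :: basis_index. basis_deg m \<le> n}" for n
  proof (rule finite_subset)
    show "{m :: basis_index. basis_deg m \<le> n} \<subseteq> UNIV \<times> {..n}" by (auto simp: basis_deg_def)
  qed auto
  then have "finite (\<Union>k\<in>Poly_Mapping.keys h. {m. basis_deg m \<le> basis_deg k})" by auto
  moreover have "{m. pairing h (act a (Poly_Mapping.single m 1)) \<noteq> 0}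
      \<subseteq> (\<Union>k\<in>Poly_Mapping.keys h. {m. basis_deg m \<le> basis_deg k})"
  proof
    fix m assume "m \<in> {m. pairing h (act a (Poly_Mapping.single m 1)) \<noteq> 0}"
    then obtain k where "k \<in> Poly_Mapping.keys (act a (Poly_Mapping.single m 1))"
      "Poly_Mapping.lookup h k * Poly_Mapping.lookup (act a (Poly_Mapping.single m 1)) k \<noteq> 0"
      unfolding pairing_def mem_Collect_eq by (rule sum.not_neutral_contains_not_neutral)
    moreover from this(1) have "basis_deg m \<le> basis_deg k" by (elim act_degree) (auto split: if_splits)
    ultimately show "m \<in> (\<Union>k\<in>Poly_Mapping.keys h. {m. basis_deg m \<le> basis_deg k})"
      by (auto simp: in_keys_iff)
  qed
  ultimately show ?thesis
    unfolding right_act_def by (subst lookup_Abs_poly_mapping) (auto intro: finite_subset)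
qed

theorem pairing_right_act: "pairing (right_act h a) u = pairing h (act a u)"
proof (induction u rule: free_module_induct)
  case (single k c)
  have "Poly_Mapping.single k c = scale c (Poly_Mapping.single k 1)" by (simp add: scale_single)
  then show ?case by (simp add: act_simps pairing_scale pairing_single lookup_right_act)
qed (auto simp: act_simps pairing_add)

lemma pairing_eqI: "(\<And>u. pairing h u = pairing h' u) \<Longrightarrow> h = h'"
proof (rule poly_mapping_eqI)
  fix m assume "\<And>u. pairing h u = pairing h' u"
  from this[of "Poly_Mapping.single m 1"]
  show "Poly_Mapping.lookup h m = Poly_Mapping.lookup h' m" by (simp add: pairing_single)
qed

lemma right_act_mult: "right_act h (a * b) = right_act (right_act h a) b"
  by (rule pairing_eqI) (simp add: pairing_right_act act_simps)

lemma act_reduced: "u \<in> reduced \<Longrightarrow> act a u \<in> reduced"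
proof -
  assume u: "u \<in> reduced"
  have "(False, 0) \<notin> Poly_Mapping.keys (act a u)"
  proof
    assume "(False, 0) \<in> Poly_Mapping.keys (act a u)"
    then obtain k where k: "k \<in> Poly_Mapping.keys u" "basis_deg k \<le> basis_deg (False, 0)" by (rule act_degree)
    then have "k = (False, 0)" by (cases k) (auto simp: basis_deg_def of_bool_def split: if_splits)
    then show False using k u by (simp add: reduced_def in_keys_iff)
  qed
  then show ?thesis by (simp add: reduced_def in_keys_iff)
qed

section \<open>Ext\<close>

text \<open>
  \<open>Ext_A^{0,t}(P, F_p)\<close> as the elements of \<open>H_t\<close> annihilated by the augmentation ideal, so that
  the class \<open>[h]\<close> is \<open>h\<close> itself; \<open>ext0_iff_linear\<close> identifies these with the \<open>A\<close>-linear maps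
  from \<open>P\<close> to \<open>F_p\<close> placed in degree \<open>t\<close>.  The graded space \<open>Ext_A^0\<close> is the (automatically
  direct) sum of these inside the homology.
\<close>

definition ext0 :: "nat \<Rightarrow> 'p::prime_card homology set" where
  "ext0 t = {h \<in> reduced_homology t. \<forall>a\<in>augmentation_ideal. right_act h a = 0}"

definition ext0_total :: "'p::prime_card homology set" where
  "ext0_total = free_module.span (\<Union>t. ext0 t)"

lemma free_act_unit:
  fixes f :: "'p::prime_card free_steenrod"
  shows "free_act f (Poly_Mapping.single (False, 0) 1)
    = scale (free_augmentation f) (Poly_Mapping.single (False, 0) 1)"
proof -
  let ?o = "Poly_Mapping.single (False, 0) 1 :: 'p cohomology"
  have g: "gen_act g ?o = (if g = Power 0 then ?o else 0)" for g
    by (cases g) (auto simp: gen_act_single binomial_eq_0)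
  have w: "word_act w ?o = (if set (letters w) \<subseteq> {Power 0} then ?o else 0)" for w
  proof -
    have "foldr gen_act gs ?o = (if set gs \<subseteq> {Power 0} then ?o else 0)" for gs
      by (induction gs) (use g in \<open>auto simp: gen_act_def\<close>)
    then show ?thesis by (simp add: word_act_def)
  qed
  show "free_act f ?o = scale (free_augmentation f) ?o"
    by (induction f rule: free_module_induct)
      (auto simp: free_act_left free_augmentation_add free_augmentation_single w scale_simps)
qed

lemma act_unit:
  "act a (Poly_Mapping.single (False, 0) 1) = scale (augmentation a) (Poly_Mapping.single (False, 0) 1)"
  by (induction a rule: steenrod.abs_induct) (simp add: act.abs_eq augmentation.abs_eq free_act_unit)

lemma ext0_iff_linear:
  fixes h :: "'p::prime_card homology"
  assumes h: "h \<in> reduced_homology t"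
  shows "h \<in> ext0 t \<longleftrightarrow> (\<forall>a. \<forall>u\<in>reduced. pairing h (act a u) = augmentation a * pairing h u)"
proof
  assume e: "h \<in> ext0 t"
  show "\<forall>a. \<forall>u\<in>reduced. pairing h (act a u) = augmentation a * pairing h u"
  proof (intro allI ballI)
    fix a :: "'p steenrod" and u :: "'p cohomology"
    obtain n where n: "augmentation a = of_nat n" using surj_of_nat_mod_ring by blast
    have aug_n: "augmentation (of_nat n :: 'p steenrod) = of_nat n" by (induction n) auto
    have act_n: "act (of_nat n) u = scale (of_nat n) u" by (induction n) (auto simp: act_simps scale_simps)
    have "a - of_nat n \<in> augmentation_ideal" by (simp add: augmentation_ideal_def n aug_n)
    then have "right_act h (a - of_nat n) = 0" using e by (simp add: ext0_def)
    then have "pairing h (act (a - of_nat n) u) = 0" by (metis pairing_right_act pairing_zero(2))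
    then show "pairing h (act a u) = augmentation a * pairing h u"
      by (simp add: act_diff act_n pairing_diff pairing_scale n)
  qed
next
  assume l: "\<forall>a. \<forall>u\<in>reduced. pairing h (act a u) = augmentation a * pairing h u"
  have "right_act h a = 0" if "a \<in> augmentation_ideal" for a :: "'p steenrod"
  proof (rule poly_mapping_eqI)
    fix m :: basis_index
    show "Poly_Mapping.lookup (right_act h a) m = Poly_Mapping.lookup 0 m"
    proof (cases "m = (False, 0)")
      case True
      then show ?thesis
        using that by (simp add: lookup_right_act act_unit augmentation_ideal_def scale_simps)
    next
      case False
      then have "(Poly_Mapping.single m 1 :: 'p cohomology) \<in> reduced" by (simp add: reduced_def lookup_single when_def)
      then show ?thesis using l that by (simp add: lookup_right_act augmentation_ideal_def)
    qed
  qed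
  then show "h \<in> ext0 t" using h by (simp add: ext0_def)
qed

definition h_hat :: "nat \<Rightarrow> 'p::prime_card homology" where
  "h_hat i = dual_basis True ((CARD('p) - 1) * CARD('p) ^ i - 1)"

definition h_hat2 :: "nat \<Rightarrow> nat \<Rightarrow> 'p::prime_card homology" where
  "h_hat2 i k = dual_basis True (k * CARD('p) ^ i - 1)"

end

theory Submission
  imports Defs
begin

text \<open>
  Every degree of the homology is at most one-dimensional, so \<open>ext0\<close> is spanned by the dual basis
  elements annihilated by the Bockstein and by all \<open>P^i\<close> with \<open>i > 0\<close>.  The Bockstein
  excludes the elements \<open>b^[t]\<close>, and \<open>P^i\<close> annihilates \<open>a b^[n]\<close> if and only if \<open>p\<close> divides
  \<open>(n - i(p-1)) choose i\<close>.  Write \<open>n + 1 = q p^j\<close> with \<open>q\<close> prime to \<open>p\<close>.  If \<open>q < p\<close>,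
  all these binomials vanish mod \<open>p\<close> by a comparison of \<open>p\<close>-adic valuations; if \<open>q > p\<close>, the one for
  \<open>i = p^j\<close> is congruent to \<open>q\<close> up to sign, hence nonzero.
\<close>

section \<open>Binomial coefficients modulo a prime\<close>

text \<open>Truncated subtraction does no harm here: for \<open>i > m\<close> both sides
  vanish.\<close>

lemma mult_binomial_absorb: "0 < i \<Longrightarrow> i * (m choose i) = (m - (i - 1)) * (m choose (i - 1))"
  using binomial_absorb_comp[of m "i - 1"] binomial_absorption[of "i - 1" m]
  by (cases m) auto

text \<open>In \<open>r * (N choose r) = N * (N - 1 choose (r - 1))\<close> with
  \<open>N = M * p ^ j\<close>, the factor \<open>r\<close> has p-adic valuation below
  \<open>j\<close>, so a factor \<open>p\<close> is left for the binomial.\<close>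

lemma prime_dvd_binomial_multiple_power:
  fixes p :: nat
  assumes p: "prime p" and r: "0 < r" "r < p ^ j"
  shows "p dvd (M * p ^ j choose r)"
proof -
  obtain v u where u: "r = p ^ v * u" "\<not> p dvd u"
    using prime_power_canonical[OF p r(1)] by (metis mult.commute)
  have "v < j"
  proof (rule ccontr)
    assume "\<not> v < j"
    then have "p ^ j \<le> p ^ v" using prime_ge_1_nat[OF p] by (intro power_increasing) auto
    also have "\<dots> \<le> r" using u r by (cases u) auto
    finally show False using r by simp
  qed
  then have "p ^ Suc v dvd M * p ^ j" by (intro dvd_mult le_imp_power_dvd) simp
  moreover have "M * p ^ j dvd r * (M * p ^ j choose r)"
  proof (cases "M * p ^ j")
    case (Suc m)
    then show ?thesis using binomial_absorption[of "r - 1" m] r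
      by (metis Suc_diff_1 Suc_times_binomial dvd_triv_left mult.commute)
  next
    case 0
    show ?thesis unfolding 0 using binomial_eq_0[OF r(1)] by simp
  qed
  ultimately have "p ^ v * p dvd p ^ v * (u * (M * p ^ j choose r))"
    unfolding u(1) by (metis dvd_trans mult.assoc mult.commute power_Suc)
  then have "p dvd u * (M * p ^ j choose r)"
    using p by (simp add: prime_gt_0_nat)
  then show ?thesis using u p by (simp add: prime_dvd_mult_iff)
qed

text \<open>By Pascal's rule, neighbouring entries of row \<open>M * p ^ j - 1\<close> add up to an
  entry of row \<open>M * p ^ j\<close> that \<open>p\<close> divides. Non-divisibility therefore
  spreads from the initial entry 1.\<close>

lemma not_prime_dvd_binomial_multiple_power_pred:
  fixes p :: nat
  assumes p: "prime p" and M: "0 < M" and r: "r < p ^ j"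
  shows "\<not> p dvd (M * p ^ j - 1 choose r)"
  using r
proof (induction r)
  case 0
  then show ?case using p by auto
next
  case (Suc r)
  have "M * p ^ j > 0" using M p by (simp add: prime_gt_0_nat)
  then obtain m where m: "M * p ^ j = Suc m" by (cases "M * p ^ j") auto
  have "p dvd (m choose r) + (m choose Suc r)"
    using prime_dvd_binomial_multiple_power[OF p _ Suc.prems, of M] m by simp
  moreover have "\<not> p dvd (m choose r)" using Suc m by simp
  ultimately show ?case unfolding m by (metis diff_Suc_1 dvd_add_left_iff add.commute)
qed

text \<open>With \<open>m = n - i * (p - 1)\<close> and \<open>i * p \<le> n\<close>, absorption
  gives \<open>i * (m choose i) = (k * p ^ j - i * p) * (m choose (i - 1))\<close>, and the first
  factor on the right has larger p-adic valuation than \<open>i\<close>.\<close>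

lemma steenrod_binomial_zero:
  fixes p :: nat
  assumes p: "prime p" and k: "0 < k" "k < p" and i: "0 < i"
    and n: "Suc n = k * p ^ j" and le: "i * (p - 1) \<le> n"
  shows "p dvd ((n - i * (p - 1)) choose i)"
proof (cases "i * p \<le> n")
  \<comment> \<open>Here the top of the binomial is smaller than \<open>i\<close>.\<close>
  case False
  have "i * p = i * (p - 1) + i" using p by (cases p) auto
  then have "n - i * (p - 1) < i" using False le by linarith
  then show ?thesis by (simp add: binomial_eq_0)
next
  case True
  let ?m = "n - i * (p - 1)"
  have ip: "i * p = i * (p - 1) + i" using p by (cases p) auto
  obtain v u where u: "i = p ^ v * u" "\<not> p dvd u"
    using prime_power_canonical[OF p i] by (metis mult.commute)
  \<comment> \<open>Otherwise \<open>p ^ j \<le> i\<close>, hence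
    \<open>p ^ j * p \<le> i * p \<le> n < k * p ^ j\<close>, which contradicts
    \<open>k < p\<close>.\<close>
  have "Suc v \<le> j"
  proof (rule ccontr)
    assume "\<not> Suc v \<le> j"
    then have "p ^ j \<le> p ^ v" using prime_ge_1_nat[OF p] by (intro power_increasing) auto
    also have "\<dots> \<le> i" using u i by (cases u) auto
    finally have "p ^ j * p \<le> n" using True by (meson le_trans mult_le_mono1)
    moreover have "n < p ^ j * p"
      using n k mult_le_mono1[of k p "p ^ j"] unfolding mult.commute[of "p ^ j" p] by linarith
    ultimately show False by simp
  qed
  then have "p ^ Suc v dvd k * p ^ j" by (intro dvd_mult le_imp_power_dvd)
  moreover have "p ^ Suc v dvd i * p" unfolding u(1) by (simp add: mult_ac)
  ultimately have "p ^ Suc v dvd k * p ^ j - i * p" by (rule dvd_diff_nat)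
  \<comment> \<open>Both sides are \<open>n + 1 - i * p\<close>; the subtractions are exact because
    \<open>i * p \<le> n\<close>.\<close>
  also have "k * p ^ j - i * p = ?m - (i - 1)" using n[symmetric] True ip i by simp
  also have "\<dots> dvd i * (?m choose i)" using mult_binomial_absorb[OF i] by simp
  finally have "p ^ v * p dvd p ^ v * (u * (?m choose i))"
    using u(1) by (metis mult.assoc mult.commute power_Suc)
  then have "p dvd u * (?m choose i)" using p by (simp add: prime_gt_0_nat)
  then show ?thesis using u p by (simp add: prime_dvd_mult_iff)
qed

text \<open>Write \<open>q = p + d\<close>. The top of the binomial is
  \<open>(d + 1) * p ^ j - 1\<close>, and absorption turns the binomial into \<open>d\<close> times
  one prime to \<open>p\<close>, where \<open>d\<close> is congruent to \<open>q\<close>.\<close>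

lemma steenrod_binomial_nonzero:
  fixes p :: nat
  assumes p: "prime p" and q: "\<not> p dvd q" "p < q" and n: "Suc n = q * p ^ j"
  shows "p ^ j * (p - 1) \<le> n" "\<not> p dvd ((n - p ^ j * (p - 1)) choose (p ^ j))"
proof -
  obtain d where d: "q = p + d" "0 < d" using q less_imp_add_positive by blast
  have pj: "p ^ j > 0" using p by (simp add: prime_gt_0_nat)
  have e: "Suc n = p ^ j * (p - 1) + Suc d * p ^ j"
    using n d p by (cases p) (auto simp: algebra_simps)
  then show "p ^ j * (p - 1) \<le> n" using pj by (cases "p ^ j") auto
  have m: "n - p ^ j * (p - 1) = Suc d * p ^ j - 1" (is "?m = _") using e by simp
  have "p ^ j * (?m choose p ^ j) = (?m - (p ^ j - 1)) * (?m choose (p ^ j - 1))"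
    using mult_binomial_absorb[OF pj] by simp
  also have "?m - (p ^ j - 1) = p ^ j * d" using m pj by simp
  finally have c: "(?m choose p ^ j) = d * (?m choose (p ^ j - 1))"
    using pj by (metis mult.assoc mult_left_cancel not_gr_zero)
  have "\<not> p dvd (?m choose (p ^ j - 1))"
    unfolding m by (rule not_prime_dvd_binomial_multiple_power_pred[OF p]) (use pj in auto)
  moreover have "\<not> p dvd d" using q d by simp
  ultimately show "\<not> p dvd (?m choose p ^ j)" unfolding c using prime_dvd_mult_iff[OF p] by blast
qed

text \<open>The guard \<open>i * (p - 1) \<le> n\<close> says that \<open>x y^(n - i(p-1))\<close>
  exists, the only basis element that \<open>P^i\<close> can send to a nonzero multiple of
  \<open>x y^n\<close>.\<close>

lemma steenrod_binomials_zero_iff: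
  fixes p :: nat
  assumes p: "prime p"
  shows "(\<forall>i>0. i * (p - 1) \<le> n \<longrightarrow> p dvd ((n - i * (p - 1)) choose i))
    \<longleftrightarrow> (\<exists>j. \<exists>k\<in>{1..<p}. Suc n = k * p ^ j)" (is "?L \<longleftrightarrow> ?R")
proof
  assume ?R
  then obtain j k where k: "0 < k" "k < p" and n: "Suc n = k * p ^ j"
    by (metis One_nat_def Suc_le_eq atLeastLessThan_iff)
  then show ?L using steenrod_binomial_zero[OF p k _ n] by blast
next
  assume L: ?L
  obtain j q where q: "Suc n = q * p ^ j" "\<not> p dvd q"
    using prime_power_canonical[OF p zero_less_Suc[of n]] by metis
  have "\<not> p < q"
  proof
    assume "p < q"
    note nz = steenrod_binomial_nonzero[OF p q(2) this q(1)]
    have "0 < p ^ j" using p by (simp add: prime_gt_0_nat)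
    then show False using L nz by blast
  qed
  \<comment> \<open>Both excluded values are multiples of \<open>p\<close>.\<close>
  moreover have "q \<noteq> p" "q > 0" using q by (auto intro: Nat.gr0I)
  ultimately show ?R using q(1) by (intro exI[of _ j] bexI[of _ q]) auto
qed

text \<open>Since \<open>k\<close> is prime to \<open>p\<close>, the p-adic valuation of
  \<open>k * p ^ i\<close> is \<open>i\<close>. This keeps the listed classes distinct.\<close>

lemma mult_prime_power_inj:
  fixes p :: nat
  assumes p: "prime p" and k: "k \<in> {1..<p}" "k' \<in> {1..<p}" and e: "k * p ^ i = k' * p ^ i'"
  shows "i = i'" "k = k'"
proof -
  have "multiplicity p (l * p ^ j) = j" if "l \<in> {1..<p}" for l j
    using that p by (intro multiplicity_eqI) (auto dest: dvd_imp_le simp: prime_gt_0_nat)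
  then show "i = i'" using e k by metis
  then show "k = k'" using e p by (simp add: prime_gt_0_nat)
qed

section \<open>The annihilator of the augmentation ideal\<close>

lemma of_nat_mod_ring_eq_0_iff:
  "(of_nat n :: 'p::prime_card mod_ring) = 0 \<longleftrightarrow> CARD('p) dvd n"
  by (simp add: of_nat_eq_0_iff_char_dvd)

text \<open>Generators suffice: the letters of a word are peeled off from the outside, which is why
  \<open>v\<close> ranges over all classes, and linearity does the rest.\<close>

lemma pairing_act_augmentation:
  fixes h :: "'p::prime_card homology"
  assumes gens: "\<And>g v. pairing h (gen_act g v) = of_bool (g = Power 0) * pairing h v"
  shows "pairing h (act a u) = augmentation a * pairing h u"
proof (induction a rule: steenrod.abs_induct)
  case (1 f)
  have "pairing h (foldr gen_act gs u) = of_bool (set gs \<subseteq> {Power 0}) * pairing h u" for gs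
    by (induction gs) (auto simp: gens)
  then have "pairing h (free_act f u) = free_augmentation f * pairing h u"
    by (induction f rule: free_module_induct)
      (auto simp: free_act_left free_augmentation_add free_augmentation_single word_act_def
        pairing_add pairing_scale distrib_right)
  then show ?case by (simp add: act.abs_eq augmentation.abs_eq)
qed

lemma pairing_dual_basis_single:
  "pairing (dual_basis e n :: 'p::prime_card homology) (Poly_Mapping.single m c)
     = c * of_bool (m = (e, n))"
  by (simp add: pairing_single dual_basis_def lookup_single when_def)

lemma dual_basis_in_reduced_homology:
  "(e, n) \<noteq> (False, 0) \<Longrightarrow> (dual_basis e n :: 'p::prime_card homology) \<in> reduced_homology (basis_deg (e, n))"
  by (auto simp: reduced_homology_def dual_basis_def)

text \<open>Among basis elements only \<open>x y^n\<close> pairs nontrivially with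
  \<open>a b^[n]\<close>. \<open>P^i\<close> reaches it only from \<open>x y^(n - i(p-1))\<close>,
  with the binomial as coefficient; the Bockstein never reaches it.\<close>

lemma dual_basis_True_in_ext0_iff:
  "(dual_basis True n :: 'p::prime_card homology) \<in> ext0 (2 * n + 1)
     \<longleftrightarrow> (\<exists>j. \<exists>k\<in>{1..<CARD('p)}. Suc n = k * CARD('p) ^ j)" (is "?h \<in> _ \<longleftrightarrow> _")
proof -
  let ?p = "CARD('p)"
  have red: "?h \<in> reduced_homology (2 * n + 1)"
    using dual_basis_in_reduced_homology[of True n] by (simp add: basis_deg_def)
  have "?h \<in> ext0 (2 * n + 1)
      \<longleftrightarrow> (\<forall>i>0. i * (?p - 1) \<le> n \<longrightarrow> ?p dvd ((n - i * (?p - 1)) choose i))" (is "_ \<longleftrightarrow> ?B")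
  proof
    assume e: "?h \<in> ext0 (2 * n + 1)"
    show ?B
    proof (intro allI impI)
      fix i :: nat assume i: "0 < i" "i * (?p - 1) \<le> n"
      have "(reduced_power i :: 'p steenrod) \<in> augmentation_ideal"
        using i by (simp add: augmentation_ideal_def augmentation_gens)
      then have "right_act ?h (reduced_power i) = 0" using e by (simp add: ext0_def)
      then have "pairing ?h (act (reduced_power i) (Poly_Mapping.single (True, n - i * (?p - 1)) 1)) = 0"
        by (metis pairing_right_act pairing_zero(2))
      then show "?p dvd ((n - i * (?p - 1)) choose i)"
        using i(2) by (simp add: act_reduced_power pairing_dual_basis_single of_nat_mod_ring_eq_0_iff)
    qed
  next
    assume B: ?B
    \<comment> \<open>The converse goes through linearity on generators, where \<open>P^0\<close>
      acts as the identity.\<close>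
    have "pairing ?h (gen_act g v) = of_bool (g = Power 0) * pairing ?h v" for g v
    proof (induction v rule: free_module_induct)
      case (single m c)
      obtain e t where m: "m = (e, t)" by (cases m)
      show ?case
      proof (cases g)
        case Bockstein
        then show ?thesis by (simp add: m gen_act_single pairing_dual_basis_single)
      next
        case (Power i)
        show ?thesis
        proof (cases "i = 0")
          case False
          have "(of_nat (t choose i) :: 'p mod_ring) = 0" if "t + i * (?p - 1) = n"
            using B[rule_format, of i] False that[symmetric] by (simp add: of_nat_mod_ring_eq_0_iff)
          then show ?thesis using False Power
            by (auto simp: m gen_act_single pairing_dual_basis_single)
        qed (simp add: Power m gen_act_single)
      qed
    qed (auto simp: gen_act_def lin_ext_add pairing_add distrib_left)
    then show "?h \<in> ext0 (2 * n + 1)"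
      unfolding ext0_iff_linear[OF red] using pairing_act_augmentation by blast
  qed
  also have "\<dots> \<longleftrightarrow> (\<exists>j. \<exists>k\<in>{1..<?p}. Suc n = k * ?p ^ j)"
    by (rule steenrod_binomials_zero_iff) (rule prime_card)
  finally show ?thesis .
qed

text \<open>The Bockstein sends \<open>x y^(n-1)\<close> to \<open>y^n\<close>; \<open>n > 0\<close>
  provides this source.\<close>

lemma dual_basis_False_notin_ext0:
  assumes "n > 0"
  shows "(dual_basis False n :: 'p::prime_card homology) \<notin> ext0 t"
proof
  let ?h = "dual_basis False n :: 'p homology"
  assume "?h \<in> ext0 t"
  moreover have "(bockstein :: 'p steenrod) \<in> augmentation_ideal"
    by (simp add: augmentation_ideal_def augmentation_gens)
  ultimately have "right_act ?h bockstein = 0" by (simp add: ext0_def)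
  then have "pairing ?h (act bockstein (Poly_Mapping.single (True, n - 1) 1)) = 0"
    by (metis pairing_right_act pairing_zero(2))
  then show False using assms by (simp add: act_bockstein pairing_dual_basis_single)
qed

lemma ext0_scale:
  assumes "h \<in> ext0 t"
  shows "scale c h \<in> ext0 t"
proof -
  have "pairing (scale c h) u = c * pairing h u" for u
    by (simp add: pairing_def sum_distrib_left mult_ac)
  then have r: "right_act (scale c h) a = scale c (right_act h a)" for a
    by (intro poly_mapping_eqI) (simp add: lookup_right_act)
  have "scale c h \<in> reduced_homology t"
    using assms by (auto simp: ext0_def reduced_homology_def in_keys_iff)
  then show ?thesis using assms by (simp add: ext0_def r scale_simps)
qed

text \<open>The parity of the degree recovers the exponent of \<open>x\<close>, and then half of the
  rest that of \<open>y\<close>.\<close>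

lemma basis_deg_inj: "basis_deg m = basis_deg m' \<Longrightarrow> m = m'"
  by (cases m; cases m') (auto simp: basis_deg_def of_bool_def split: if_splits; presburger)

text \<open>A degree contains at most one dual basis element, so \<open>h\<close> is a multiple of
  it. Dividing by the nonzero coefficient puts that element itself into \<open>ext0 t\<close>, where
  the criteria above apply.\<close>

lemma ext0_cases:
  fixes h :: "'p::prime_card homology"
  assumes h: "h \<in> ext0 t" "h \<noteq> 0"
  obtains c j k n where "h = scale c (dual_basis True n)" "k \<in> {1..<CARD('p)}" "Suc n = k * CARD('p) ^ j"
proof -
  obtain e n where m: "(e, n) \<in> Poly_Mapping.keys h"
    using h(2) by (metis keys_eq_empty equals0I surj_pair)
  let ?c = "Poly_Mapping.lookup h (e, n)"
  have keys: "m' \<noteq> (False, 0) \<and> basis_deg m' = t" if "m' \<in> Poly_Mapping.keys h" for m'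
    using h(1) that by (auto simp: ext0_def reduced_homology_def)
  have "Poly_Mapping.lookup h m' = 0" if "m' \<noteq> (e, n)" for m'
    using keys[OF m] keys[of m'] basis_deg_inj[of m' "(e, n)"] that by (auto simp: in_keys_iff)
  then have hc: "h = scale ?c (dual_basis e n)"
    by (intro poly_mapping_eqI) (auto simp: dual_basis_def lookup_single when_def)
  have c: "?c \<noteq> 0" using m by (simp add: in_keys_iff)
  have d: "dual_basis e n \<in> (ext0 t :: 'p homology set)"
  proof -
    have "scale (inverse ?c) h = dual_basis e n"
      by (subst hc) (use c in \<open>simp add: scale_simps\<close>)
    then show ?thesis using ext0_scale[OF h(1)] by metis
  qed
  \<comment> \<open>Reducedness excludes \<open>(False, 0)\<close>, so for \<open>e = False\<close>
    the exponent \<open>n\<close> is positive and the Bockstein rules this case out.\<close>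
  have "e"
    using d keys[OF m] dual_basis_False_notin_ext0[of n t] by (cases e) auto
  then have e: "e = True" by simp
  have "t = 2 * n + 1" using keys[OF m] e by (simp add: basis_deg_def)
  then obtain j k where "k \<in> {1..<CARD('p)}" "Suc n = k * CARD('p) ^ j"
    using d e dual_basis_True_in_ext0_iff by blast
  then show ?thesis using that hc e by blast
qed

section \<open>Linear independence and the basis\<close>

lemma independent_dual_basis:
  assumes "S \<subseteq> range (\<lambda>(e, n). dual_basis e n)"
  shows "free_module.independent (S :: 'p::prime_card homology set)"
  unfolding free_module.independent_explicit_module
proof (intro allI impI)
  fix T and f :: "'p homology \<Rightarrow> 'p mod_ring" and v
  assume T: "finite T" "T \<subseteq> S" and z: "(\<Sum>w\<in>T. scale (f w) w) = 0" and v: "v \<in> T"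
  obtain e n where en: "v = dual_basis e n" using assms T v by fastforce
  \<comment> \<open>The \<open>(e, n)\<close> coordinate singles out \<open>v\<close> among the
    elements of \<open>T\<close>, so reading it off the relation isolates
    \<open>f v\<close>.\<close>
  have l: "Poly_Mapping.lookup w (e, n) = of_bool (w = v)" if wT: "w \<in> T" for w
  proof -
    obtain e' n' where w: "w = dual_basis e' n'" using assms T wT by fastforce
    show ?thesis
      by (auto simp: w en dual_basis_def lookup_single when_def dest: arg_cong[of _ _ Poly_Mapping.keys])
  qed
  have "0 = (\<Sum>w\<in>T. f w * Poly_Mapping.lookup w (e, n))"
    using arg_cong[OF z, of "\<lambda>w. Poly_Mapping.lookup w (e, n)"] by (simp add: lookup_sum)
  also have "\<dots> = (\<Sum>w\<in>T. if w = v then f w else 0)" by (rule sum.cong) (auto simp: l)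
  finally show "f v = 0" using T v by (simp add: sum.delta)
qed

lemma dual_basis_inj: "(dual_basis e n :: 'p::prime_card homology) = dual_basis e' n' \<Longrightarrow> e = e' \<and> n = n'"
  unfolding dual_basis_def by (drule arg_cong[of _ _ Poly_Mapping.keys]) simp

theorem theorem3p1:
  assumes "odd CARD('p::prime_card)"
  shows
    "(\<forall>i. (h_hat i :: 'p homology) \<in> ext0 (2 * (CARD('p) - 1) * CARD('p) ^ i - 1)) \<and>
     (\<forall>i. \<forall>k\<in>{1..<CARD('p) - 1}. (h_hat2 i k :: 'p homology) \<in> ext0 (2 * k * CARD('p) ^ i - 1)) \<and>
     (let basis = case_sum h_hat (\<lambda>(i, k). h_hat2 i k) :: nat + nat \<times> nat \<Rightarrow> 'p homology;
          I = UNIV <+> UNIV \<times> {1..<CARD('p) - 1}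
      in inj_on basis I \<and> free_module.independent (basis ` I) \<and>
         free_module.span (basis ` I) = ext0_total)"
proof -
  let ?p = "CARD('p)"
  have p: "prime ?p" by (rule prime_card)
  have p2: "?p \<ge> 2" using p by (rule prime_ge_2_nat)
  \<comment> \<open>Both families have this shape: \<open>k = p - 1\<close> gives
    \<open>h_hat\<close>, smaller \<open>k\<close> give \<open>h_hat2\<close>.\<close>
  define D :: "nat \<Rightarrow> nat \<Rightarrow> 'p homology" where "D i k = dual_basis True (k * ?p ^ i - 1)" for i k
  have pos: "k * ?p ^ i > 0" if "k \<in> {1..<?p}" for i k using that by simp
  have ext: "D i k \<in> ext0 (2 * k * ?p ^ i - 1)" if k: "k \<in> {1..<?p}" for i k
  proof -
    have "Suc (k * ?p ^ i - 1) = k * ?p ^ i" using pos[OF k, of i] by simp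
    then have "D i k \<in> ext0 (2 * (k * ?p ^ i - 1) + 1)"
      unfolding D_def dual_basis_True_in_ext0_iff using k by blast
    \<comment> \<open>The degree of \<open>a b^[n]\<close> is \<open>2n + 1\<close>; positivity of
      \<open>k * ?p ^ i\<close> keeps the subtraction exact.\<close>
    moreover have "2 * (k * ?p ^ i - 1) + 1 = 2 * k * ?p ^ i - 1" using pos[OF k, of i] unfolding mult.assoc by linarith
    ultimately show ?thesis by simp
  qed
  have D_inj: "i = i' \<and> k = k'" if e: "D i k = D i' k'" and k: "k \<in> {1..<?p}" "k' \<in> {1..<?p}" for i k i' k'
  proof -
    have "k * ?p ^ i - 1 = k' * ?p ^ i' - 1" using e dual_basis_inj unfolding D_def by blast
    then have "k * ?p ^ i = k' * ?p ^ i'" using pos[OF k(1), of i] pos[OF k(2), of i'] by linarith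
    then show ?thesis using mult_prime_power_inj[OF p k] by blast
  qed
  define basis where "basis = (case_sum h_hat (\<lambda>(i, k). h_hat2 i k) :: nat + nat \<times> nat \<Rightarrow> 'p homology)"
  define I :: "(nat + nat \<times> nat) set" where "I = UNIV <+> UNIV \<times> {1..<?p - 1}"
  have hat: "h_hat i = D i (?p - 1)" "h_hat2 i k = D i k" for i k
    by (simp_all add: h_hat_def h_hat2_def D_def)
  have last: "?p - 1 \<in> {1..<?p}" using p2 by auto
  \<comment> \<open>On the disjoint sum this also separates the two families, as
    \<open>k = p - 1\<close> occurs only in the left summand.\<close>
  have "inj_on basis I"
  proof (rule inj_onI)
    fix x y assume "x \<in> I" "y \<in> I" "basis x = basis y"
    then show "x = y" using last
      by (auto simp: I_def basis_def hat dest!: D_inj split: sum.splits)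
  qed
  moreover have "free_module.independent (basis ` I)"
  proof (rule independent_dual_basis)
    have "D i k \<in> range (\<lambda>(e, n). dual_basis e n)" for i k
      unfolding D_def by (rule range_eqI[of _ _ "(True, _)"]) simp
    then show "basis ` I \<subseteq> range (\<lambda>(e, n). dual_basis e n)"
      by (auto simp: I_def basis_def hat)
  qed
  moreover have "free_module.span (basis ` I) = ext0_total"
  proof
    have "basis ` I \<subseteq> (\<Union>t. ext0 t)"
      using ext last by (fastforce simp: I_def basis_def hat)
    then show "free_module.span (basis ` I) \<subseteq> ext0_total"
      unfolding ext0_total_def by (rule free_module.span_mono)
    have D_basis: "D j k \<in> basis ` I" if "k \<in> {1..<?p}" for j k
    proof (cases "k = ?p - 1")
      case True
      then show ?thesis by (intro rev_image_eqI[of "Inl j"]) (auto simp: I_def basis_def hat)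
    next
      case False
      then show ?thesis using that by (intro rev_image_eqI[of "Inr (j, k)"]) (auto simp: I_def basis_def hat)
    qed
    \<comment> \<open>The total space is spanned by homogeneous classes, so a single such
      \<open>h\<close> is enough.\<close>
    have "h \<in> free_module.span (basis ` I)" if "h \<in> ext0 t" for h t
    proof (cases "h = 0")
      case True
      then show ?thesis by (simp add: free_module.span_zero)
    next
      case False
      obtain c j k n where hc: "h = scale c (dual_basis True n)" and k: "k \<in> {1..<?p}"
        and n: "Suc n = k * ?p ^ j"
        using ext0_cases[OF \<open>h \<in> ext0 t\<close> False] by metis
      have "n = k * ?p ^ j - 1" using n by linarith
      then have "h = scale c (D j k)" using hc by (simp add: D_def)
      then show ?thesis using D_basis[OF k]
        by (simp add: free_module.span_base free_module.span_scale)
    qed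
    then show "ext0_total \<subseteq> free_module.span (basis ` I)"
      unfolding ext0_total_def
      by (intro free_module.span_minimal free_module.subspace_span) auto
  qed
  moreover have "(h_hat i :: 'p homology) \<in> ext0 (2 * (?p - 1) * ?p ^ i - 1)" for i
    using ext[OF last] by (simp only: hat)
  moreover have "(h_hat2 i k :: 'p homology) \<in> ext0 (2 * k * ?p ^ i - 1)" if "k \<in> {1..<?p - 1}" for i k
    using ext[of k i] that by (simp only: hat) auto
  ultimately show ?thesis unfolding Let_def basis_def I_def by blast
qed

end
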